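(* $\mathsf{RCA}_0$ proves: for any finite set $\mathcal{S}$ of diagrams, $\mathrm{ucl}(\widehat{\mathcal{S}})=\overline{\mathcal{S}}\cup\mathrm{ucl}(\mathcal{S})$. Moreover $\mathrm{ucl}(\widehat{\mathcal{S}})$ is closed, includes $\mathcal{S}$, and is included in every closed set of diagrams that includes $\mathcal{S}$.
   Context: A diagram (Young diagram) is a partition $m_1\ge\cdots\ge m_k>0$ with $k>0$, viewed as left-justified rows of boxes; $|D|$ is the number of boxes. $r_i(D)$ is the length of the $i$th row (0 if none), $c_i(D)$ the length of the $i$th column. $D\le E$ means $r_i(D)\le r_i(E)$ for all $i$; $D<E$ means $D\le E$, $D\ne E$. $D\cup E$ is the diagram with rows $\max(r_i(D),r_i(E))$. $\mathrm{ucl}(\mathcal{T})=\{E:\exists D\in\mathcal{T},\ D\le E\}$. A set $\mathcal{U}$ of diagrams is closed if for every diagram $D$: $D\in\mathcal{U}\iff\forall E\,(E>D\Rightarrow E\in\mathcal{U})$. $(D)_r$ is the diagram with $r_1((D)_r)=\max(r_2(D),1)$ and $r_i((D)_r)=r_i(D)$ for $i>1$; $(D)_c$ is the diagram with $c_1((D)_c)=\max(c_2(D),1)$ and $c_i((D)_c)=c_i(D)$ for $i>1$. For finite $\mathcal{S}$: $\widehat{\mathcal{S}}=\{(D)_r\cup(E)_c: D,E\in\mathcal{S}\}$, $\|\mathcal{S}\|=\max\{(r_1(D)-1)(c_1(E)-1): D,E\in\mathcal{S}\}$, and $\overline{\mathcal{S}}=\{F\in\mathrm{ucl}(\widehat{\mathcal{S}}):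 |F|\le\|\mathcal{S}\|\}$. *)

theory Defs
  imports Main
begin

text \<open>
  Provability in \<open>RCA\<^sub>0\<close> is rendered as truth in every model of \<open>RCA\<^sub>0\<close> (two-sorted first-order,
  that is Henkin, semantics).  The first-order part of a structure for the language of
  second-order arithmetic is a whole type \<open>'m\<close>; the second sort is a nonempty collection of
  subsets of \<open>'m\<close>.
\<close>

record 'm l2_structure =
  Zero :: 'm  ("\<zero>\<index>")
  One  :: 'm  ("\<one>\<index>")
  Add  :: "'m \<Rightarrow> 'm \<Rightarrow> 'm"  (infixl "\<oplus>\<index>" 65)
  Mult :: "'m \<Rightarrow> 'm \<Rightarrow> 'm"  (infixl "\<otimes>\<index>" 70)
  Less :: "'m \<Rightarrow> 'm \<Rightarrow> bool"  (infix "\<prec>\<index>" 50)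
  Sets :: "'m set set"

datatype l2_term =
    Var nat | TZero | TOne | TAdd l2_term l2_term | TMult l2_term l2_term

text \<open>
  The \<open>\<Sigma>\<^sup>0\<^sub>0\<close> formulas: number quantifiers are bounded, and sets enter only as free set
  variables, numbered separately from the number variables.  \<open>FBAll x t \<phi>\<close> is \<open>\<forall>x<t. \<phi>\<close>; in
  \<open>sat\<close> its bound \<open>t\<close> is evaluated outside the scope of \<open>x\<close>.
\<close>

datatype sigma00 =
    FEq l2_term l2_term | FLess l2_term l2_term | FMem l2_term nat
  | FNot sigma00 | FAnd sigma00 sigma00 | FBAll nat l2_term sigma00

locale l2 =
  fixes M :: "'m l2_structure" (structure)
begin

primrec tval :: "(nat \<Rightarrow> 'm) \<Rightarrow> l2_term \<Rightarrow> 'm" where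
  "tval e (Var x) = e x"
| "tval e TZero = \<zero>"
| "tval e TOne = \<one>"
| "tval e (TAdd s t) = tval e s \<oplus> tval e t"
| "tval e (TMult s t) = tval e s \<otimes> tval e t"

primrec sat :: "(nat \<Rightarrow> 'm) \<Rightarrow> (nat \<Rightarrow> 'm set) \<Rightarrow> sigma00 \<Rightarrow> bool" where
  "sat e A (FEq s t) \<longleftrightarrow> tval e s = tval e t"
| "sat e A (FLess s t) \<longleftrightarrow> tval e s \<prec> tval e t"
| "sat e A (FMem t X) \<longleftrightarrow> tval e t \<in> A X"
| "sat e A (FNot \<phi>) \<longleftrightarrow> \<not> sat e A \<phi>"
| "sat e A (FAnd \<phi> \<psi>) \<longleftrightarrow> sat e A \<phi> \<and> sat e A \<psi>"
| "sat e A (FBAll x t \<phi>) \<longleftrightarrow> (\<forall>a. a \<prec> tval e t \<longrightarrow> sat (e(x := a)) A \<phi>)"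

text \<open>
  The properties of \<open>n\<close> expressed by \<open>\<exists>y. \<phi>(x,y)\<close> and \<open>\<forall>y. \<phi>(x,y)\<close> with \<open>x\<close> interpreted as \<open>n\<close>;
  \<open>e\<close> and \<open>A\<close> supply the number and set parameters.
\<close>

definition sigma01 ::
  "(nat \<Rightarrow> 'm) \<Rightarrow> (nat \<Rightarrow> 'm set) \<Rightarrow> nat \<Rightarrow> nat \<Rightarrow> sigma00 \<Rightarrow> 'm \<Rightarrow> bool" where
  "sigma01 e A x y \<phi> n \<longleftrightarrow> (\<exists>m. sat (e(x := n, y := m)) A \<phi>)"

definition pi01 ::
  "(nat \<Rightarrow> 'm) \<Rightarrow> (nat \<Rightarrow> 'm set) \<Rightarrow> nat \<Rightarrow> nat \<Rightarrow> sigma00 \<Rightarrow> 'm \<Rightarrow> bool" where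
  "pi01 e A x y \<phi> n \<longleftrightarrow> (\<forall>m. sat (e(x := n, y := m)) A \<phi>)"

end

locale rca0 = l2 M for M :: "'m l2_structure" (structure) +
  assumes sets_nonempty: "Sets M \<noteq> {}"
    and add_one_neq_zero: "\<And>n. n \<oplus> \<one> \<noteq> \<zero>"
    and add_one_inject: "\<And>m n. m \<oplus> \<one> = n \<oplus> \<one> \<Longrightarrow> m = n"
    and add_zero: "\<And>m. m \<oplus> \<zero> = m"
    and add_add_one: "\<And>m n. m \<oplus> (n \<oplus> \<one>) = (m \<oplus> n) \<oplus> \<one>"
    and mult_zero: "\<And>m. m \<otimes> \<zero> = \<zero>"
    and mult_add_one: "\<And>m n. m \<otimes> (n \<oplus> \<one>) = (m \<otimes> n) \<oplus> m"
    and not_less_zero: "\<And>m. \<not> m \<prec> \<zero>"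
    and less_add_one: "\<And>m n. m \<prec> n \<oplus> \<one> \<longleftrightarrow> m \<prec> n \<or> m = n"
    and sigma01_induction:
      "\<And>e A x y \<phi> n. range A \<subseteq> Sets M \<Longrightarrow> x \<noteq> y \<Longrightarrow> sigma01 e A x y \<phi> \<zero> \<Longrightarrow>
        (\<And>k. sigma01 e A x y \<phi> k \<Longrightarrow> sigma01 e A x y \<phi> (k \<oplus> \<one>)) \<Longrightarrow> sigma01 e A x y \<phi> n"
    and delta01_comprehension:
      "\<And>e A x y \<phi> \<psi>. range A \<subseteq> Sets M \<Longrightarrow> x \<noteq> y \<Longrightarrow>
        (\<And>n. sigma01 e A x y \<phi> n \<longleftrightarrow> pi01 e A x y \<psi> n) \<Longrightarrow>
        \<exists>X\<in>Sets M. \<forall>n. n \<in> X \<longleftrightarrow> sigma01 e A x y \<phi> n"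

context l2
begin

text \<open>
  Everything below is the interpretation in \<open>M\<close> of a notion of second-order arithmetic:
  quantified elements are numbers of \<open>M\<close>, and sets of numbers occur either as members of
  \<open>Sets M\<close> or as classes definable in \<open>M\<close>.  Descriptions (\<open>THE\<close>) denote objects that \<open>RCA\<^sub>0\<close> proves
  to exist uniquely.
\<close>

definition leq :: "'m \<Rightarrow> 'm \<Rightarrow> bool"  (infix "\<preceq>" 50) where
  "m \<preceq> n \<longleftrightarrow> m \<prec> n \<or> m = n"

definition maximum :: "'m \<Rightarrow> 'm \<Rightarrow> 'm" where
  "maximum m n = (if m \<prec> n then n else m)"

definition divides :: "'m \<Rightarrow> 'm \<Rightarrow> bool" where
  "divides m n \<longleftrightarrow> (\<exists>k. n = m \<otimes> k)"

definition pair :: "'m \<Rightarrow> 'm \<Rightarrow> 'm" where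
  "pair i j = (i \<oplus> j) \<otimes> (i \<oplus> j) \<oplus> i"

text \<open>
  Codes of finite sets and of finite sequences, as in Simpson's Subsystems of Second Order
  Arithmetic: the code of a finite set \<open>X\<close> is the least number \<open>(k,(m,n))\<close> such that
  \<open>i \<in> X\<close> iff \<open>i < k\<close> and \<open>m(i+1)+1\<close> divides \<open>n\<close>; a finite sequence of length \<open>l\<close> is the finite set
  of the pairs \<open>(i,s\<^sub>i)\<close>, \<open>i < l\<close>, and is identified with the code of that set.
\<close>

definition beta_set :: "'m \<Rightarrow> 'm \<Rightarrow> 'm \<Rightarrow> 'm set" where
  "beta_set k m n = {i. i \<prec> k \<and> divides (m \<otimes> (i \<oplus> \<one>) \<oplus> \<one>) n}"

definition elts :: "'m \<Rightarrow> 'm set" where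
  "elts c = {i. \<exists>k m n. c = pair k (pair m n) \<and> i \<in> beta_set k m n}"

definition set_code :: "'m \<Rightarrow> bool" where
  "set_code c \<longleftrightarrow> (\<exists>k m n. c = pair k (pair m n)) \<and>
     (\<forall>k m n. beta_set k m n = elts c \<longrightarrow> c \<preceq> pair k (pair m n))"

definition fin_seq :: "'m \<Rightarrow> 'm \<Rightarrow> bool" where
  "fin_seq s l \<longleftrightarrow> set_code s \<and>
     (\<forall>n\<in>elts s. \<exists>i j. n = pair i j) \<and>
     (\<forall>i j k. pair i j \<in> elts s \<and> pair i k \<in> elts s \<longrightarrow> j = k) \<and>
     (\<forall>i. i \<prec> l \<longleftrightarrow> (\<exists>j. pair i j \<in> elts s))"

definition entry :: "'m \<Rightarrow> 'm \<Rightarrow> 'm" where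
  "entry s i = (if \<exists>j. pair i j \<in> elts s then THE j. pair i j \<in> elts s else \<zero>)"

text \<open>
  Rows and columns are numbered from \<open>0\<close>: \<open>row D i\<close> is \<open>r\<^sub>i\<^sub>+\<^sub>1(D)\<close> and \<open>col D j\<close> is \<open>c\<^sub>j\<^sub>+\<^sub>1(D)\<close>.
\<close>

abbreviation row :: "'m \<Rightarrow> 'm \<Rightarrow> 'm" where
  "row \<equiv> entry"

definition diagram :: "'m \<Rightarrow> bool" where
  "diagram D \<longleftrightarrow> (\<exists>k. fin_seq D k \<and> \<zero> \<prec> k \<and> (\<forall>i. i \<prec> k \<longrightarrow> \<zero> \<prec> row D i) \<and>
     (\<forall>i j. i \<prec> j \<and> j \<prec> k \<longrightarrow> row D j \<preceq> row D i))"

text \<open>Column \<open>j\<close> consists of the boxes in position \<open>j\<close> of the rows \<open>i < c\<close>, for \<open>c\<close> its length.\<close>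

definition col :: "'m \<Rightarrow> 'm \<Rightarrow> 'm" where
  "col D j = (THE c. \<forall>i. i \<prec> c \<longleftrightarrow> j \<prec> row D i)"

text \<open>The number of boxes is the sum of the row lengths; \<open>s\<close> is the sequence of partial sums.\<close>

definition size :: "'m \<Rightarrow> 'm" where
  "size D = (THE n. \<exists>s k. fin_seq D k \<and> fin_seq s (k \<oplus> \<one>) \<and> entry s \<zero> = \<zero> \<and>
     (\<forall>i. i \<prec> k \<longrightarrow> entry s (i \<oplus> \<one>) = entry s i \<oplus> row D i) \<and> n = entry s k)"

definition dle :: "'m \<Rightarrow> 'm \<Rightarrow> bool" where
  "dle D E \<longleftrightarrow> (\<forall>i. row D i \<preceq> row E i)"

definition dless :: "'m \<Rightarrow> 'm \<Rightarrow> bool" where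
  "dless D E \<longleftrightarrow> dle D E \<and> D \<noteq> E"

definition dunion :: "'m \<Rightarrow> 'm \<Rightarrow> 'm" where
  "dunion D E = (THE F. diagram F \<and> (\<forall>i. row F i = maximum (row D i) (row E i)))"

definition reduce_r :: "'m \<Rightarrow> 'm" where
  "reduce_r D = (THE F. diagram F \<and> row F \<zero> = maximum (row D \<one>) \<one> \<and>
     (\<forall>i. \<zero> \<prec> i \<longrightarrow> row F i = row D i))"

definition reduce_c :: "'m \<Rightarrow> 'm" where
  "reduce_c D = (THE F. diagram F \<and> col F \<zero> = maximum (col D \<one>) \<one> \<and>
     (\<forall>j. \<zero> \<prec> j \<longrightarrow> col F j = col D j))"

definition diagram_set :: "'m set \<Rightarrow> bool" where
  "diagram_set T \<longleftrightarrow> T \<in> Sets M \<and> (\<forall>D\<in>T. diagram D)"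

text \<open>In \<open>RCA\<^sub>0\<close> a set of numbers is finite if it is bounded; this is finiteness in the sense of \<open>M\<close>.\<close>

definition finite_diagram_set :: "'m set \<Rightarrow> bool" where
  "finite_diagram_set T \<longleftrightarrow> diagram_set T \<and> (\<exists>k. \<forall>D\<in>T. D \<prec> k)"

definition ucl :: "'m set \<Rightarrow> 'm set" where
  "ucl T = {E. diagram E \<and> (\<exists>D\<in>T. dle D E)}"

definition closed :: "'m set \<Rightarrow> bool" where
  "closed U \<longleftrightarrow> (\<forall>D. diagram D \<longrightarrow> (D \<in> U \<longleftrightarrow> (\<forall>E. diagram E \<and> dless D E \<longrightarrow> E \<in> U)))"

definition hat :: "'m set \<Rightarrow> 'm set" where
  "hat S = {dunion (reduce_r D) (reduce_c E) | D E. D \<in> S \<and> E \<in> S}"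

text \<open>\<open>p\<close> and \<open>q\<close> are \<open>r\<^sub>1(D) - 1\<close> and \<open>c\<^sub>1(E) - 1\<close>.\<close>

definition norm_values :: "'m set \<Rightarrow> 'm set" where
  "norm_values S = {p \<otimes> q | p q. \<exists>D\<in>S. \<exists>E\<in>S. row D \<zero> = p \<oplus> \<one> \<and> col E \<zero> = q \<oplus> \<one>}"

definition norm :: "'m set \<Rightarrow> 'm" where
  "norm S = (THE n. n \<in> norm_values S \<and> (\<forall>v\<in>norm_values S. v \<preceq> n))"

text \<open>
  For empty \<open>S\<close> the value \<open>norm S\<close> is unspecified, but then \<open>hat S\<close>, and hence \<open>bar S\<close>, is empty.
\<close>

definition bar :: "'m set \<Rightarrow> 'm set" where
  "bar S = {F \<in> ucl (hat S). size F \<preceq> norm S}"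

end

end

theory Submission
  imports Defs
begin

text \<open>
  The combinatorics is short.  If \<open>F\<close> lies above \<open>(D)\<^sub>r\<close> and \<open>(E)\<^sub>c\<close> but not above \<open>D\<close> or \<open>E\<close>, then
  \<open>r\<^sub>1(F) < r\<^sub>1(D)\<close> and \<open>c\<^sub>1(F) < c\<^sub>1(E)\<close>, so \<open>F\<close> has at most \<open>(r\<^sub>1(D) - 1)(c\<^sub>1(E) - 1)\<close> boxes.  For closedness,
  a box added to the first row or column of \<open>D\<close> is invisible to \<open>(A)\<^sub>r\<close> or \<open>(B)\<^sub>c\<close>, respectively.  For
  minimality, among the elements of \<open>ucl(hat S)\<close> outside a closed set \<open>U \<supseteq> S\<close>, all of size at most
  \<open>norm S\<close>, one of maximal size would have all its proper extensions in \<open>U\<close>.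

  The work lies in doing this inside a model, with only \<open>\<Sigma>\<^sup>0\<^sub>1\<close> induction and \<open>\<Delta>\<^sup>0\<^sub>1\<close> comprehension.
  Formulas are replaced by predicates on environments \<open>e :: nat \<Rightarrow> 'm\<close> with de Bruijn indices, so
  that definability is proved by introduction rules; sequences exist by Goedel's beta function.
\<close>

section \<open>Bounded formulas as predicates on environments\<close>

text \<open>For minimality the maximum is taken over sizes and not over diagrams: the sizes of the
  elements of \<open>ucl (hat S)\<close> outside \<open>U\<close> are bounded by
  \<open>norm S\<close>, and this bound is all that \<open>sigma1_greatest\<close> asks for besides
  a \<open>\<Sigma>\<^sup>0\<^sub>1\<close> description. Such a description exists because
  \<open>U\<close> and \<open>ucl (hat S)\<close> are both sets of the model; hence the existence of
  \<open>ucl (hat S)\<close> in \<open>Sets M\<close>, itself part of the claim, has to precede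
  minimality. A second obstacle is that \<open>size\<close>, \<open>norm\<close>,
  \<open>dunion\<close>, \<open>col\<close> and both reductions are given by descriptions. Nothing
  follows from them until the object is shown to exist uniquely in \<open>M\<close>, and they cannot
  enter a definable predicate as they stand. They are therefore replaced: unions and reductions by
  explicit row lengths, columns by comparisons with rows, sizes by the recursive function
  \<open>psum\<close>, and the values behind \<open>norm\<close> by a
  \<open>\<Sigma>\<^sup>0\<^sub>1\<close> form of \<open>norm_values\<close>.\<close>

primrec rename_term :: "(nat \<Rightarrow> nat) \<Rightarrow> l2_term \<Rightarrow> l2_term" where
  "rename_term f (Var x) = Var (f x)"
| "rename_term f TZero = TZero"
| "rename_term f TOne = TOne"
| "rename_term f (TAdd s t) = TAdd (rename_term f s) (rename_term f t)"
| "rename_term f (TMult s t) = TMult (rename_term f s) (rename_term f t)"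

primrec rename :: "(nat \<Rightarrow> nat) \<Rightarrow> (nat \<Rightarrow> nat) \<Rightarrow> sigma00 \<Rightarrow> sigma00" where
  "rename f g (FEq s t) = FEq (rename_term f s) (rename_term f t)"
| "rename f g (FLess s t) = FLess (rename_term f s) (rename_term f t)"
| "rename f g (FMem t X) = FMem (rename_term f t) (g X)"
| "rename f g (FNot \<phi>) = FNot (rename f g \<phi>)"
| "rename f g (FAnd \<phi> \<psi>) = FAnd (rename f g \<phi>) (rename f g \<psi>)"
| "rename f g (FBAll x t \<phi>) = FBAll (f x) (rename_term f t) (rename f g \<phi>)"

text \<open>Even variables carry the environment, odd ones the parameters.\<close>

definition join :: "(nat \<Rightarrow> 'a) \<Rightarrow> (nat \<Rightarrow> 'a) \<Rightarrow> nat \<Rightarrow> 'a" where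
  "join p e n = (if even n then e (n div 2) else p (n div 2))"

text \<open>Parameters are interleaved a second time: in \<open>join (join q p) e\<close> those of
  \<open>p\<close> sit at the indices congruent to 1 modulo 4 and those of \<open>q\<close> at the
  indices congruent to 3. Representations with different parameters are thereby moved to common
  ones.\<close>

lemma join_left: "join (join q p) e \<circ> (\<lambda>n. if even n then n else 2 * n - 1) = join p e"
proof
  fix n show "(join (join q p) e \<circ> (\<lambda>n. if even n then n else 2 * n - 1)) n = join p e n"
    by (cases "even n"; cases n) (auto elim!: oddE simp: join_def)
qed

lemma join_right: "join (join q p) e \<circ> (\<lambda>n. if even n then n else 2 * n + 1) = join q e"
proof
  fix n show "(join (join q p) e \<circ> (\<lambda>n. if even n then n else 2 * n + 1)) n = join q e n"
    by (cases "even n") (auto elim!: oddE simp: join_def)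
qed

text \<open>A quantifier of \<open>sigma00\<close> rebinds a single variable, whereas a de Bruijn
  binder shifts the whole environment. Moving \<open>p\<close> up one place frees variable 1 to act
  as the bound variable; the renaming sends environment variable 0 there and lowers the others. The
  placeholder \<open>z\<close> is overwritten.\<close>

lemma join_bind:
  "(join (case_nat z p) e)(1 := a) \<circ> (\<lambda>n. if n = 0 then 1 else if even n then n - 2 else n + 2)
    = join p (case_nat a e)"
proof
  fix n
  show "((join (case_nat z p) e)(1 := a) \<circ>
      (\<lambda>n. if n = 0 then 1 else if even n then n - 2 else n + 2)) n = join p (case_nat a e) n"
    by (cases "even n") (auto elim!: oddE evenE simp: join_def split: nat.split)
qed

lemma join_shift: "join (case_nat z p) e \<circ> (\<lambda>n. if even n then n else n + 2) = join p e"
proof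
  fix n show "(join (case_nat z p) e \<circ> (\<lambda>n. if even n then n else n + 2)) n = join p e n"
    by (cases "even n") (auto elim!: oddE simp: join_def)
qed

lemma inj_parity: "inj (\<lambda>n::nat. if even n then n else 2 * n - 1)"
    "inj (\<lambda>n::nat. if even n then n else 2 * n + 1)"
    "inj (\<lambda>n::nat. if n = 0 then 1 else if even n then n - 2 else n + 2)"
  by (auto simp: inj_def; presburger)+

context l2
begin

lemma tval_rename: "tval e (rename_term f t) = tval (e \<circ> f) t"
  by (induction t) auto

text \<open>Injectivity prevents capture: updating the environment at \<open>f x\<close> must not
  change the value of any other renamed variable.\<close>

lemma sat_rename: "inj f \<Longrightarrow> sat e A (rename f g \<phi>) \<longleftrightarrow> sat (e \<circ> f) (A \<circ> g) \<phi>"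
proof (induction \<phi> arbitrary: e)
  case (FBAll x t \<phi>)
  have "e(f x := a) \<circ> f = (e \<circ> f)(x := a)" for a
    using FBAll.prems by (auto simp: fun_eq_iff inj_eq)
  with FBAll show ?case by (simp add: tval_rename del: o_apply fun_upd_apply)
qed (auto simp: tval_rename)

text \<open>Every element of the model may serve as a constant, because the induction and
  comprehension schemes admit number parameters through the environment.\<close>

inductive tm :: "((nat \<Rightarrow> 'm) \<Rightarrow> 'm) \<Rightarrow> bool" where
  tm_var: "tm (\<lambda>e. e i)"
| tm_const: "tm (\<lambda>e. c)"
| tm_add: "tm s \<Longrightarrow> tm t \<Longrightarrow> tm (\<lambda>e. s e \<oplus> t e)"
| tm_mult: "tm s \<Longrightarrow> tm t \<Longrightarrow> tm (\<lambda>e. s e \<otimes> t e)"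

text \<open>In \<open>delta0_ball\<close> the bound element becomes variable 0 and the rest of the
  environment moves up by one. All later quantifier rules have this shape.\<close>

inductive delta0 :: "((nat \<Rightarrow> 'm) \<Rightarrow> bool) \<Rightarrow> bool" where
  delta0_eq: "tm s \<Longrightarrow> tm t \<Longrightarrow> delta0 (\<lambda>e. s e = t e)"
| delta0_less: "tm s \<Longrightarrow> tm t \<Longrightarrow> delta0 (\<lambda>e. s e \<prec> t e)"
| delta0_mem: "tm t \<Longrightarrow> X \<in> Sets M \<Longrightarrow> delta0 (\<lambda>e. t e \<in> X)"
| delta0_not: "delta0 P \<Longrightarrow> delta0 (\<lambda>e. \<not> P e)"
| delta0_conj: "delta0 P \<Longrightarrow> delta0 Q \<Longrightarrow> delta0 (\<lambda>e. P e \<and> Q e)"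
| delta0_ball: "tm t \<Longrightarrow> delta0 (\<lambda>e. P (e 0) (\<lambda>i. e (Suc i))) \<Longrightarrow> delta0 (\<lambda>e. \<forall>a. a \<prec> t e \<longrightarrow> P a e)"

definition tm_repr where
  "tm_repr p s t \<longleftrightarrow> (\<forall>e. t e = tval (join p e) s)"

definition delta0_repr where
  "delta0_repr p A \<phi> P \<longleftrightarrow> (\<forall>e. P e \<longleftrightarrow> sat (join p e) A \<phi>)"

lemma tm_repr_left: "tm_repr p s t \<Longrightarrow> \<exists>s'. tm_repr (join q p) s' t"
  unfolding tm_repr_def by (metis tval_rename join_left)

lemma tm_repr_right: "tm_repr q s t \<Longrightarrow> \<exists>s'. tm_repr (join q p) s' t"
  unfolding tm_repr_def by (metis tval_rename join_right)

lemma delta0_repr_left: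
  assumes "delta0_repr p A \<phi> P"
  obtains \<phi>' where "delta0_repr (join q p) (join B A) \<phi>' P"
proof
  have "join B A \<circ> (\<lambda>n. 2 * n) = A" by (auto simp: join_def)
  with assms show "delta0_repr (join q p) (join B A)
      (rename (\<lambda>n. if even n then n else 2 * n - 1) (\<lambda>n. 2 * n) \<phi>) P"
    by (simp add: delta0_repr_def sat_rename inj_parity join_left)
qed

lemma delta0_repr_right:
  assumes "delta0_repr q B \<phi> P"
  obtains \<phi>' where "delta0_repr (join q p) (join B A) \<phi>' P"
proof
  have "join B A \<circ> (\<lambda>n. 2 * n + 1) = B" by (auto simp: join_def)
  with assms show "delta0_repr (join q p) (join B A)
      (rename (\<lambda>n. if even n then n else 2 * n + 1) (\<lambda>n. 2 * n + 1) \<phi>) P"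
    by (simp add: delta0_repr_def sat_rename inj_parity join_right)
qed

lemma tm_representable: "tm t \<Longrightarrow> \<exists>p s. tm_repr p s t"
proof (induction rule: tm.induct)
  case (tm_var i)
  have "tm_repr p (Var (2 * i)) (\<lambda>e. e i)" for p by (simp add: tm_repr_def join_def)
  then show ?case by blast
next
  case (tm_const c)
  have "tm_repr (\<lambda>_. c) (Var 1) (\<lambda>e. c)" by (simp add: tm_repr_def join_def)
  then show ?case by blast
next
  case (tm_add s t)
  then obtain p s' t' where "tm_repr p s' s" "tm_repr p t' t"
    by (meson tm_repr_left tm_repr_right)
  then have "tm_repr p (TAdd s' t') (\<lambda>e. s e \<oplus> t e)" by (simp add: tm_repr_def)
  then show ?case by blast
next
  case (tm_mult s t)
  then obtain p s' t' where "tm_repr p s' s" "tm_repr p t' t"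
    by (meson tm_repr_left tm_repr_right)
  then have "tm_repr p (TMult s' t') (\<lambda>e. s e \<otimes> t e)" by (simp add: tm_repr_def)
  then show ?case by blast
qed

lemma tm_representable2: "tm s \<Longrightarrow> tm t \<Longrightarrow> \<exists>p s' t'. tm_repr p s' s \<and> tm_repr p t' t"
  by (meson tm_representable tm_repr_left tm_repr_right)

lemma range_join: "range A \<subseteq> X \<Longrightarrow> range B \<subseteq> X \<Longrightarrow> range (join A B) \<subseteq> X"
  by (auto simp: join_def image_subset_iff)

end

context rca0
begin

lemma sets: "\<exists>A :: nat \<Rightarrow> 'm set. range A \<subseteq> Sets M"
proof -
  obtain X where "X \<in> Sets M" using sets_nonempty by blast
  then have "range (\<lambda>_ :: nat. X) \<subseteq> Sets M" by auto
  then show ?thesis by blast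
qed

text \<open>The way back from predicates to syntax, through which the axiom schemes become
  applicable. Number constants are collected in \<open>p\<close> and set constants in
  \<open>A\<close>.\<close>

lemma delta0_representable: "delta0 P \<Longrightarrow> \<exists>p A \<phi>. range A \<subseteq> Sets M \<and> delta0_repr p A \<phi> P"
proof (induction rule: delta0.induct)
  case (delta0_eq s t)
  then obtain p s' t' where "tm_repr p s' s" "tm_repr p t' t" by (meson tm_representable2)
  then have "delta0_repr p A (FEq s' t') (\<lambda>e. s e = t e)" for A
    by (simp add: tm_repr_def delta0_repr_def)
  with sets show ?case by blast
next
  case (delta0_less s t)
  then obtain p s' t' where "tm_repr p s' s" "tm_repr p t' t" by (meson tm_representable2)
  then have "delta0_repr p A (FLess s' t') (\<lambda>e. s e \<prec> t e)" for A
    by (simp add: tm_repr_def delta0_repr_def)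
  with sets show ?case by blast
next
  case (delta0_mem t X)
  then obtain p t' where "tm_repr p t' t" by (meson tm_representable)
  then have "delta0_repr p (\<lambda>_. X) (FMem t' 0) (\<lambda>e. t e \<in> X)"
    by (simp add: tm_repr_def delta0_repr_def)
  moreover have "range (\<lambda>_ :: nat. X) \<subseteq> Sets M" using delta0_mem by auto
  ultimately show ?case by blast
next
  case (delta0_not P)
  then obtain p A \<phi> where "range A \<subseteq> Sets M" "delta0_repr p A \<phi> P" by blast
  then have "range A \<subseteq> Sets M \<and> delta0_repr p A (FNot \<phi>) (\<lambda>e. \<not> P e)" by (simp add: delta0_repr_def)
  then show ?case by blast
next
  case (delta0_conj P Q)
  obtain p A \<phi> where 1: "range A \<subseteq> Sets M" "delta0_repr p A \<phi> P"
    using delta0_conj.IH(1) by blast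
  obtain q B \<psi> where 2: "range B \<subseteq> Sets M" "delta0_repr q B \<psi> Q"
    using delta0_conj.IH(2) by blast
  note * = 1 2
  obtain \<phi>' where 1: "delta0_repr (join q p) (join B A) \<phi>' P" by (rule delta0_repr_left[OF *(2)])
  obtain \<psi>' where 2: "delta0_repr (join q p) (join B A) \<psi>' Q" by (rule delta0_repr_right[OF *(4)])
  have "delta0_repr (join q p) (join B A) (FAnd \<phi>' \<psi>') (\<lambda>e. P e \<and> Q e)"
    using 1 2 by (simp add: delta0_repr_def)
  with range_join[OF *(3,1)] show ?case by blast
next
  case (delta0_ball t P)
  obtain p t' where 1: "tm_repr p t' t" using tm_representable[OF delta0_ball(1)] by blast
  obtain q A \<phi> where 2: "range A \<subseteq> Sets M" "delta0_repr q A \<phi> (\<lambda>e. P (e 0) (\<lambda>i. e (Suc i)))"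
    using delta0_ball.IH by blast
  note * = 1 2
  obtain s where s: "tm_repr (join q p) s t" using tm_repr_left[OF *(1)] by blast
  obtain \<psi> where \<psi>: "delta0_repr (join q p) (join A A) \<psi> (\<lambda>e. P (e 0) (\<lambda>i. e (Suc i)))"
    by (rule delta0_repr_right[OF *(3)])
  let ?r = "case_nat \<zero> (join q p)"
  let ?s = "rename_term (\<lambda>n. if even n then n else n + 2) s"
  let ?f = "\<lambda>n. if n = 0 then 1 else if even n then n - 2 else n + 2"
  have "P a e \<longleftrightarrow> sat ((join ?r e)(1 := a)) (join A A) (rename ?f id \<psi>)" for a e
  proof -
    have "P a e \<longleftrightarrow> sat (join (join q p) (case_nat a e)) (join A A) \<psi>"
      using \<psi>[unfolded delta0_repr_def, rule_format, of "case_nat a e"] by simp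
    also have "\<dots> \<longleftrightarrow> sat ((join ?r e)(1 := a)) (join A A) (rename ?f id \<psi>)"
      by (subst sat_rename[OF inj_parity(3)]) (simp only: join_bind comp_id)
    finally show ?thesis .
  qed
  moreover have "t e = tval (join ?r e) ?s" for e
    using s by (simp add: tm_repr_def tval_rename join_shift)
  ultimately have "delta0_repr ?r (join A A) (FBAll 1 ?s (rename ?f id \<psi>)) (\<lambda>e. \<forall>a. a \<prec> t e \<longrightarrow> P a e)"
    by (simp add: delta0_repr_def)
  with range_join[OF *(2,2)] show ?case by blast
qed

text \<open>
  Environment variable \<open>0\<close> is the witness and \<open>1\<close> the free variable.  The two predicates are
  represented with common parameters, as \<open>delta01_comprehension\<close> demands.
\<close>

lemma sigma01_pi01_of_delta0:
  assumes "delta0 (\<lambda>e. Q (e 0) (e (Suc 0)))" "delta0 (\<lambda>e. R (e 0) (e (Suc 0)))"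
  obtains e A \<phi> \<psi> where "range A \<subseteq> Sets M" "\<And>n. sigma01 e A 2 0 \<phi> n \<longleftrightarrow> (\<exists>m. Q m n)"
    "\<And>n. pi01 e A 2 0 \<psi> n \<longleftrightarrow> (\<forall>m. R m n)"
proof -
  obtain p A \<phi> where 1: "range A \<subseteq> Sets M" "delta0_repr p A \<phi> (\<lambda>e. Q (e 0) (e (Suc 0)))"
    using delta0_representable[OF assms(1)] by blast
  obtain q B \<psi> where 2: "range B \<subseteq> Sets M" "delta0_repr q B \<psi> (\<lambda>e. R (e 0) (e (Suc 0)))"
    using delta0_representable[OF assms(2)] by blast
  note * = 1 2
  let ?p = "join q p" and ?A = "join B A"
  obtain \<phi>' where 1: "delta0_repr ?p ?A \<phi>' (\<lambda>e. Q (e 0) (e (Suc 0)))" by (rule delta0_repr_left[OF *(2)])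
  obtain \<psi>' where 2: "delta0_repr ?p ?A \<psi>' (\<lambda>e. R (e 0) (e (Suc 0)))" by (rule delta0_repr_right[OF *(4)])
  \<comment> \<open>Environment variables 0 and 1 are the formula variables 0 and 2, hence the
    indices in the statement.\<close>
  have "join ?p (case_nat m (case_nat n (\<lambda>_. \<zero>))) = (join ?p (\<lambda>_. \<zero>))(2 := n, 0 := m)" for m n
  proof
    fix i show "join ?p (case_nat m (case_nat n (\<lambda>_. \<zero>))) i = ((join ?p (\<lambda>_. \<zero>))(2 := n, 0 := m)) i"
      by (auto simp: join_def elim!: evenE split: nat.splits)
  qed
  with 1 2 have "sat ((join ?p (\<lambda>_. \<zero>))(2 := n, 0 := m)) ?A \<phi>' \<longleftrightarrow> Q m n"
      "sat ((join ?p (\<lambda>_. \<zero>))(2 := n, 0 := m)) ?A \<psi>' \<longleftrightarrow> R m n" for m n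
    unfolding delta0_repr_def by (metis One_nat_def nat.case)+
  then show ?thesis
    using that[of ?A "join ?p (\<lambda>_. \<zero>)" \<phi>' \<psi>'] range_join[OF *(3,1)]
    unfolding sigma01_def pi01_def by simp
qed

lemma sigma_induct:
  assumes "delta0 (\<lambda>e. Q (e 0) (e (Suc 0)))" and P: "\<And>n. P n \<longleftrightarrow> (\<exists>m. Q m n)"
    and "P \<zero>" "\<And>n. P n \<Longrightarrow> P (n \<oplus> \<one>)"
  shows "P n"
proof (rule sigma01_pi01_of_delta0[OF assms(1,1)])
  fix e A \<phi>
  assume "range A \<subseteq> Sets M" and Q: "\<And>n. sigma01 e A 2 0 \<phi> n \<longleftrightarrow> (\<exists>m. Q m n)"
  then show "P n"
    using sigma01_induction[of A 2 0 e \<phi> n] assms(3,4) by (simp add: P)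
qed

lemma delta0_induct [case_names zero step delta0]:
  assumes "P \<zero>" "\<And>n. P n \<Longrightarrow> P (n \<oplus> \<one>)" "delta0 (\<lambda>e. P (e (Suc 0)))"
  shows "P n"
  by (rule sigma_induct[where Q = "\<lambda>_. P"]) (use assms in auto)

text \<open>The axiom asks for a \<open>\<Pi>\<^sup>0\<^sub>1\<close> form of \<open>P\<close>; it
  is the negation of the \<open>\<Sigma>\<^sup>0\<^sub>1\<close> form of the complement, so the
  second matrix enters negated.\<close>

lemma comprehension:
  assumes "delta0 (\<lambda>e. Q (e 0) (e (Suc 0)))" "delta0 (\<lambda>e. R (e 0) (e (Suc 0)))"
    and P: "\<And>n. P n \<longleftrightarrow> (\<exists>m. Q m n)" "\<And>n. \<not> P n \<longleftrightarrow> (\<exists>m. R m n)"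
  shows "{n. P n} \<in> Sets M"
proof (rule sigma01_pi01_of_delta0[OF assms(1) delta0_not[OF assms(2)]])
  fix e A \<phi> \<psi>
  assume "range A \<subseteq> Sets M" and "\<And>n. sigma01 e A 2 0 \<phi> n \<longleftrightarrow> (\<exists>m. Q m n)"
    and "\<And>n. pi01 e A 2 0 \<psi> n \<longleftrightarrow> (\<forall>m. \<not> R m n)"
  with P have "\<exists>X\<in>Sets M. \<forall>n. n \<in> X \<longleftrightarrow> P n"
    using delta01_comprehension[of A 2 0 e \<phi> \<psi>] by (metis zero_neq_numeral)
  then show ?thesis by (metis Collect_mem_eq Collect_cong)
qed

lemma zero_add: "\<zero> \<oplus> n = n"
proof (induct n rule: delta0_induct)
  case delta0 show ?case by (intro delta0.intros tm.intros)
qed (simp_all add: add_zero add_add_one)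

end

section \<open>Arithmetic\<close>

context l2
begin

lemma delta0_disj: "delta0 P \<Longrightarrow> delta0 Q \<Longrightarrow> delta0 (\<lambda>e. P e \<or> Q e)"
  using delta0_not[OF delta0_conj[OF delta0_not delta0_not], of P Q] by simp

lemma delta0_imp: "delta0 P \<Longrightarrow> delta0 Q \<Longrightarrow> delta0 (\<lambda>e. P e \<longrightarrow> Q e)"
  unfolding imp_conv_disj by (intro delta0_disj delta0_not)

lemma delta0_iff: "delta0 P \<Longrightarrow> delta0 Q \<Longrightarrow> delta0 (\<lambda>e. P e \<longleftrightarrow> Q e)"
  unfolding iff_conv_conj_imp by (intro delta0_conj delta0_imp)

lemma delta0_bex:
  "tm t \<Longrightarrow> delta0 (\<lambda>e. P (e 0) (\<lambda>i. e (Suc i))) \<Longrightarrow> delta0 (\<lambda>e. \<exists>a. a \<prec> t e \<and> P a e)"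
  using delta0_not[OF delta0_ball[OF _ delta0_not, of t P]] by simp

lemmas delta0_intros = tm.intros delta0_eq delta0_less delta0_mem delta0_not delta0_conj delta0_ball
  delta0_disj delta0_imp delta0_iff delta0_bex

lemma tm_subst: "tm t \<Longrightarrow> (\<And>i. tm (\<lambda>e. f e i)) \<Longrightarrow> tm (\<lambda>e. t (f e))"
  by (induction rule: tm.induct) (auto intro: tm.intros)

text \<open>Later uses take for \<open>f\<close> rearrangements of the variables, written with
  nested \<open>case_nat\<close>. Below a binder, variable 0 stays in place and the substituted
  terms are shifted past it.\<close>

lemma delta0_subst: "delta0 P \<Longrightarrow> (\<And>i. tm (\<lambda>e. f e i)) \<Longrightarrow> delta0 (\<lambda>e. P (f e))"
proof (induction arbitrary: f rule: delta0.induct)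
  case (delta0_ball t P)
  let ?f = "\<lambda>e. case_nat (e 0) (f (\<lambda>i. e (Suc i)))"
  have *: "tm (\<lambda>e. ?f e i)" for i
    using tm_subst[OF delta0_ball.prems, of "\<lambda>e i. e (Suc i)" "i - 1"]
    by (cases i) (auto intro: tm.intros)
  from delta0_ball.IH[of ?f, OF *] have "delta0 (\<lambda>e. P (e 0) (f (\<lambda>i. e (Suc i))))" by simp
  then show ?case by (rule delta0.delta0_ball[OF tm_subst[OF delta0_ball.hyps(1) delta0_ball.prems]])
next
  case (delta0_eq s t)
  show ?case by (rule delta0.delta0_eq[OF tm_subst[OF delta0_eq(1,3)] tm_subst[OF delta0_eq(2,3)]])
next
  case (delta0_less s t)
  show ?case by (rule delta0.delta0_less[OF tm_subst[OF delta0_less(1,3)] tm_subst[OF delta0_less(2,3)]])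
next
  case (delta0_mem t X)
  show ?case by (rule delta0.delta0_mem[OF tm_subst[OF delta0_mem(1,3)] delta0_mem(2)])
next
  case (delta0_not P)
  show ?case by (rule delta0.delta0_not[OF delta0_not.IH[OF delta0_not.prems]])
next
  case (delta0_conj P Q)
  show ?case by (rule delta0.delta0_conj[OF delta0_conj.IH(1)[OF delta0_conj.prems] delta0_conj.IH(2)[OF delta0_conj.prems]])
qed

end

context rca0
begin

section \<open>Semiring laws and the order of the model\<close>

lemma one_add: "\<one> \<oplus> n = n \<oplus> \<one>"
proof (induct n rule: delta0_induct)
  case delta0 show ?case by (intro delta0_intros)
qed (simp_all add: add_zero zero_add add_add_one)

lemma add_assoc: "(a \<oplus> b) \<oplus> n = a \<oplus> (b \<oplus> n)"
proof (induct n rule: delta0_induct)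
  case delta0 show ?case by (intro delta0_intros)
qed (simp_all add: add_zero add_add_one)

lemma add_commute: "a \<oplus> n = n \<oplus> a"
proof (induct n rule: delta0_induct)
  case (step n)
  then show ?case by (metis add_assoc one_add)
next
  case delta0 show ?case by (intro delta0_intros)
qed (simp_all add: add_zero zero_add)

lemma zero_mult: "\<zero> \<otimes> n = \<zero>"
proof (induct n rule: delta0_induct)
  case delta0 show ?case by (intro delta0_intros)
qed (simp_all add: mult_zero add_zero mult_add_one)

lemma add_left_commute: "a \<oplus> (b \<oplus> c) = b \<oplus> (a \<oplus> c)"
  by (metis add_assoc add_commute)

lemma add_one_mult: "(a \<oplus> \<one>) \<otimes> n = a \<otimes> n \<oplus> n"
proof (induct n rule: delta0_induct)
  case (step n)
  then show ?case by (simp add: mult_add_one add_assoc add_left_commute add_commute)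
next
  case delta0 show ?case by (intro delta0_intros)
qed (simp_all add: mult_zero add_zero)

lemma mult_commute: "a \<otimes> n = n \<otimes> a"
proof (induct n rule: delta0_induct)
  case delta0 show ?case by (intro delta0_intros)
qed (simp_all add: mult_zero zero_mult mult_add_one add_one_mult)

lemma distrib: "(a \<oplus> b) \<otimes> n = a \<otimes> n \<oplus> b \<otimes> n"
proof (induct n rule: delta0_induct)
  case (step n)
  then show ?case by (simp add: mult_add_one add_assoc add_left_commute)
next
  case delta0 show ?case by (intro delta0_intros)
qed (simp_all add: mult_zero add_zero)

lemma mult_assoc: "(a \<otimes> b) \<otimes> n = a \<otimes> (b \<otimes> n)"
proof (induct n rule: delta0_induct)
  case (step n)
  then show ?case by (metis mult_add_one mult_commute distrib)
next
  case delta0 show ?case by (intro delta0_intros)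
qed (simp_all add: mult_zero)

lemma mult_left_commute: "a \<otimes> (b \<otimes> c) = b \<otimes> (a \<otimes> c)"
  by (metis mult_assoc mult_commute)

lemma distrib_left: "n \<otimes> (a \<oplus> b) = n \<otimes> a \<oplus> n \<otimes> b"
  by (simp only: mult_commute[of n] distrib)

lemma one_mult: "\<one> \<otimes> n = n"
  by (metis mult_add_one mult_commute mult_zero zero_add)

lemma mult_one: "n \<otimes> \<one> = n"
  by (metis one_mult mult_commute)

lemma add_right_cancel: "a \<oplus> n = b \<oplus> n \<Longrightarrow> a = b"
proof (induct n rule: delta0_induct)
  case (step n)
  then show ?case by (metis add_one_inject add_add_one)
next
  case delta0 show ?case by (intro delta0_intros)
qed (simp_all add: add_zero)

lemma less_add: "a \<prec> a \<oplus> (n \<oplus> \<one>)"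
proof (induct n rule: delta0_induct)
  case (step n)
  then show ?case by (simp add: less_add_one add_add_one)
next
  case zero show ?case by (simp add: zero_add less_add_one)
next
  case delta0 show ?case by (intro delta0_intros)
qed

text \<open>The induction statement asserts the existence of the difference without a bound, so it
  needs \<open>sigma_induct\<close> in place of \<open>delta0_induct\<close>. Transitivity,
  irreflexivity and linearity then rest on this additive description of the order.\<close>

lemma less_imp_add: "a \<prec> n \<Longrightarrow> \<exists>k. n = a \<oplus> (k \<oplus> \<one>)"
proof -
  have "a \<prec> n \<longrightarrow> (\<exists>k. n = a \<oplus> (k \<oplus> \<one>))"
  proof (rule sigma_induct[where Q = "\<lambda>k n. a \<prec> n \<longrightarrow> n = a \<oplus> (k \<oplus> \<one>)" and n = n])
    show "delta0 (\<lambda>e. a \<prec> e (Suc 0) \<longrightarrow> e (Suc 0) = a \<oplus> (e 0 \<oplus> \<one>))" by (intro delta0_intros)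
    fix n assume "a \<prec> n \<longrightarrow> (\<exists>k. n = a \<oplus> (k \<oplus> \<one>))"
    then show "a \<prec> n \<oplus> \<one> \<longrightarrow> (\<exists>k. n \<oplus> \<one> = a \<oplus> (k \<oplus> \<one>))"
      by (metis less_add_one add_add_one zero_add)
  qed (use not_less_zero in auto)
  then show "a \<prec> n \<Longrightarrow> \<exists>k. n = a \<oplus> (k \<oplus> \<one>)" by blast
qed

lemma less_iff_add: "a \<prec> n \<longleftrightarrow> (\<exists>k. n = a \<oplus> (k \<oplus> \<one>))"
  using less_imp_add less_add by blast

lemma less_trans: "a \<prec> b \<Longrightarrow> b \<prec> c \<Longrightarrow> a \<prec> c"
  unfolding less_iff_add by (metis add_assoc)

lemma less_irrefl: "\<not> a \<prec> a"
proof
  assume "a \<prec> a"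
  then obtain k where "a = a \<oplus> (k \<oplus> \<one>)" using less_iff_add by blast
  then have "\<zero> \<oplus> a = (k \<oplus> \<one>) \<oplus> a" by (metis zero_add add_commute)
  then show False using add_right_cancel add_one_neq_zero by metis
qed

lemma zero_less_add_one: "\<zero> \<prec> n \<oplus> \<one>"
  using less_add[of \<zero> n] by (simp add: zero_add)

lemma zero_or_add_one: "n = \<zero> \<or> (\<exists>k. n = k \<oplus> \<one>)"
proof -
  have "n = \<zero> \<or> \<zero> \<prec> n"
  proof (induct n rule: delta0_induct)
    case delta0 show ?case by (intro delta0_intros)
  qed (auto simp: zero_less_add_one)
  then show ?thesis using less_imp_add zero_add by metis
qed

lemma linear: "a \<prec> n \<or> a = n \<or> n \<prec> a"
proof (induct n rule: delta0_induct)
  case zero show ?case using zero_or_add_one zero_less_add_one by metis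
next
  case (step n)
  have "a = n \<oplus> \<one> \<or> n \<oplus> \<one> \<prec> a" if n: "n \<prec> a"
  proof -
    obtain k where k: "a = n \<oplus> (k \<oplus> \<one>)" using less_imp_add[OF n] by blast
    consider "k = \<zero>" | j where "k = j \<oplus> \<one>" using zero_or_add_one by blast
    then show ?thesis
    proof cases
      case 1 then show ?thesis by (simp add: k zero_add)
    next
      case 2
      then have "a = (n \<oplus> \<one>) \<oplus> (j \<oplus> \<one>)"
        by (simp add: k add_assoc add_left_commute)
      then show ?thesis using less_iff_add by blast
    qed
  qed
  with step show ?case by (auto simp: less_add_one)
next
  case delta0 show ?case by (intro delta0_intros)
qed

section \<open>Truncated subtraction and the model as an ordered semiring\<close>

definition monus :: "'m \<Rightarrow> 'm \<Rightarrow> 'm" where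
  "monus a b = (if b \<preceq> a then THE c. a = b \<oplus> c else \<zero>)"

lemma monus_add: "monus (b \<oplus> c) b = c"
proof -
  have "b \<preceq> b \<oplus> c"
    using zero_or_add_one[of c] less_add[of b] by (auto simp: leq_def add_zero)
  moreover have "(THE d. b \<oplus> c = b \<oplus> d) = c"
    by (rule the_equality) (use add_right_cancel[of _ b] add_commute[of b] in auto)
  ultimately show ?thesis by (simp add: monus_def)
qed

lemma monus_zero: "\<not> b \<preceq> a \<Longrightarrow> monus a b = \<zero>"
  by (simp add: monus_def)

lemma leq_iff_add: "a \<preceq> b \<longleftrightarrow> (\<exists>k. b = a \<oplus> k)"
  unfolding leq_def less_iff_add using zero_or_add_one add_zero by metis

lemma mult_less:
  assumes "a \<prec> b" "\<zero> \<prec> c" shows "c \<otimes> a \<prec> c \<otimes> b"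
proof -
  obtain k j where b: "b = a \<oplus> (k \<oplus> \<one>)" and c: "c = j \<oplus> \<one>"
    using assms zero_or_add_one[of c] less_iff_add less_irrefl by blast
  have "c \<otimes> b = c \<otimes> a \<oplus> (c \<otimes> k \<oplus> c)"
    unfolding b by (simp only: distrib_left mult_commute[of c \<one>] one_mult)
  also have "c \<otimes> k \<oplus> c = (c \<otimes> k \<oplus> j) \<oplus> \<one>"
    by (subst (2) c) (rule add_add_one)
  finally show ?thesis using less_add by metis
qed

text \<open>The operations are components of the record \<open>M\<close> and not type class
  constants, so the library facts about ordered semirings, divisibility included, are obtained by
  interpretation under the prefix \<open>ar\<close>.\<close>

sublocale ar: linordered_semidom where
  plus = "(\<oplus>)" and zero = "\<zero>" and minus = monus and one = "\<one>" and times = "(\<otimes>)"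
  and less_eq = "(\<preceq>)" and less = "(\<prec>)"
proof unfold_locales
  fix a b c
  show "a \<oplus> b \<oplus> c = a \<oplus> (b \<oplus> c)" by (rule add_assoc)
  show "a \<oplus> b = b \<oplus> a" by (rule add_commute)
  show "monus (a \<oplus> b) a = b" by (rule monus_add)
  show "monus (monus a b) c = monus a (b \<oplus> c)"
  proof (cases "b \<oplus> c \<preceq> a")
    case True
    then show ?thesis by (metis leq_iff_add monus_add add_assoc)
  next
    case False
    show ?thesis
    proof (cases "b \<preceq> a")
      case True
      then obtain d where d: "a = b \<oplus> d" using leq_iff_add by blast
      then have "\<not> c \<preceq> d" using False leq_iff_add add_assoc by metis
      then show ?thesis by (simp add: d False[unfolded d] monus_add monus_zero)
    next
      case b: False
      then have "monus \<zero> c = \<zero>"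
        by (metis leq_def monus_add monus_zero zero_add zero_or_add_one zero_less_add_one leq_iff_add
           less_trans less_irrefl not_less_zero)
      then show ?thesis using b False by (simp add: monus_zero)
    qed
  qed
  show "a \<otimes> monus b c = monus (a \<otimes> b) (a \<otimes> c)"
  proof (cases "c \<preceq> b")
    case True
    then obtain d where "b = c \<oplus> d" using leq_iff_add by blast
    then show ?thesis by (simp add: monus_add mult_commute[of a] distrib)
  next
    case False
    then have "b \<prec> c" using linear by (auto simp: leq_def)
    show ?thesis
    proof (cases "a = \<zero>")
      case True
      then show ?thesis using monus_add[of \<zero> \<zero>] by (simp add: zero_mult zero_add)
    next
      case a: False
      then have "\<zero> \<prec> a" using zero_or_add_one zero_less_add_one by metis
      from mult_less[OF \<open>b \<prec> c\<close> this] have "\<not> a \<otimes> c \<preceq> a \<otimes> b"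
        using less_trans less_irrefl leq_def by metis
      then show ?thesis using False by (simp add: monus_zero mult_zero)
    qed
  qed
  show "a \<preceq> b \<Longrightarrow> c \<oplus> a \<preceq> c \<oplus> b" by (metis leq_iff_add add_assoc)
  show "a \<preceq> b \<or> b \<preceq> a" using linear by (auto simp: leq_def)
  show "(a \<prec> b) = (a \<preceq> b \<and> \<not> b \<preceq> a)"
    using linear less_trans less_irrefl by (metis leq_def)
  show "a \<preceq> b \<Longrightarrow> b \<preceq> c \<Longrightarrow> a \<preceq> c" using less_trans leq_def by metis
  show "a \<preceq> b \<Longrightarrow> b \<preceq> a \<Longrightarrow> a = b" using less_trans less_irrefl leq_def by metis
  show "b \<preceq> a \<Longrightarrow> monus a b \<oplus> b = a" by (metis leq_iff_add monus_add add_commute)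
  show "\<zero> \<noteq> \<one>" using add_one_neq_zero[of \<zero>] by (simp add: zero_add)
  show "\<zero> \<prec> \<one>" using zero_less_add_one[of \<zero>] by (simp add: zero_add)
  show "a \<prec> b \<Longrightarrow> \<zero> \<prec> c \<Longrightarrow> c \<otimes> a \<prec> c \<otimes> b" by (rule mult_less)
  have "\<zero> \<prec> a" if "a \<noteq> \<zero>" for a
    using that zero_or_add_one zero_less_add_one by metis
  then show "a \<noteq> \<zero> \<Longrightarrow> b \<noteq> \<zero> \<Longrightarrow> a \<otimes> b \<noteq> \<zero>"
    using mult_less[of \<zero> b a] less_irrefl by (auto simp: mult_zero)
qed (simp_all add: zero_add add_zero add_commute mult_assoc mult_commute mult_left_commute
  distrib distrib_left one_mult mult_one mult_zero leq_def)

lemma less_add_one_iff: "a \<prec> b \<oplus> \<one> \<longleftrightarrow> a \<preceq> b"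
  by (simp add: less_add_one leq_def)

lemma add_one_leq_iff: "a \<oplus> \<one> \<preceq> b \<longleftrightarrow> a \<prec> b"
  by (metis ar.not_less less_add_one_iff)

lemma zero_leq [simp]: "\<zero> \<preceq> a"
  using not_less_zero ar.not_less by blast

end

section \<open>The classes of \<open>\<Sigma>\<^sup>0\<^sub>1\<close> and \<open>\<Delta>\<^sup>0\<^sub>1\<close> predicates\<close>

context l2
begin

definition sigma1 :: "((nat \<Rightarrow> 'm) \<Rightarrow> bool) \<Rightarrow> bool" where
  "sigma1 P \<longleftrightarrow> (\<exists>Q. delta0 (\<lambda>e. Q (e 0) (\<lambda>i. e (Suc i))) \<and> (\<forall>e. P e \<longleftrightarrow> (\<exists>m. Q m e)))"

definition delta1 :: "((nat \<Rightarrow> 'm) \<Rightarrow> bool) \<Rightarrow> bool" where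
  "delta1 P \<longleftrightarrow> sigma1 P \<and> sigma1 (\<lambda>e. \<not> P e)"

text \<open>Asking for a \<open>\<Sigma>\<^sup>0\<^sub>1\<close> graph is enough because functions
  of HOL are total: both a predicate of \<open>f e\<close> and its negation can be expressed by an
  existential quantifier over the value, which is how \<open>delta1_let\<close> works.\<close>

definition recfn :: "((nat \<Rightarrow> 'm) \<Rightarrow> 'm) \<Rightarrow> bool" where
  "recfn f \<longleftrightarrow> sigma1 (\<lambda>e. e 0 = f (\<lambda>i. e (Suc i)))"

lemma sigma1I: "delta0 (\<lambda>e. Q (e 0) (\<lambda>i. e (Suc i))) \<Longrightarrow> (\<And>e. P e \<longleftrightarrow> (\<exists>m. Q m e)) \<Longrightarrow> sigma1 P"
  unfolding sigma1_def by blast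

lemma sigma1E:
  assumes "sigma1 P"
  obtains Q where "delta0 (\<lambda>e. Q (e 0) (\<lambda>i. e (Suc i)))" "P = (\<lambda>e. \<exists>m. Q m e)"
proof -
  obtain Q where "delta0 (\<lambda>e. Q (e 0) (\<lambda>i. e (Suc i)))" and "\<forall>e. P e \<longleftrightarrow> (\<exists>m. Q m e)"
    using assms unfolding sigma1_def by blast
  then show thesis by (intro that ext) auto
qed

lemma tm_case_nat: "tm t \<Longrightarrow> (\<And>i. tm (\<lambda>e. f e i)) \<Longrightarrow> tm (\<lambda>e. case_nat (t e) (f e) i)"
  by (cases i) auto

lemma sigma1_delta0: "delta0 P \<Longrightarrow> sigma1 P"
  by (rule sigma1I[of "\<lambda>_. P"]) (auto intro: delta0_subst[of P "\<lambda>e i. e (Suc i)"] tm_var)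

lemma sigma1_subst:
  assumes "sigma1 P" and f: "\<And>i. tm (\<lambda>e. f e i)"
  shows "sigma1 (\<lambda>e. P (f e))"
proof -
  obtain Q where Q: "delta0 (\<lambda>e. Q (e 0) (\<lambda>i. e (Suc i)))" and P: "P = (\<lambda>e. \<exists>m. Q m e)"
    using assms(1) by (rule sigma1E)
  have "tm (\<lambda>e. case_nat (e 0) (f (\<lambda>i. e (Suc i))) i)" for i
    by (intro tm_case_nat tm_var tm_subst[OF f])
  from delta0_subst[OF Q, of "\<lambda>e. case_nat (e 0) (f (\<lambda>i. e (Suc i)))", OF this]
  have "delta0 (\<lambda>e. Q (e 0) (f (\<lambda>i. e (Suc i))))" by simp
  then show ?thesis by (rule sigma1I) (simp add: P)
qed

lemma sigma1_shift: "sigma1 P \<Longrightarrow> sigma1 (\<lambda>e. P (\<lambda>i. e (Suc i)))"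
  by (rule sigma1_subst) (auto intro: tm_var)

lemma sigma1_shift1:
  assumes "sigma1 (\<lambda>e. P (e 0) (\<lambda>i. e (Suc i)))"
  shows "sigma1 (\<lambda>e. P (e 0) (\<lambda>i. e (Suc (Suc i))))"
proof -
  have "tm (\<lambda>e. case_nat (e 0) (\<lambda>i. e (Suc (Suc i))) i)" for i
    by (intro tm_case_nat tm_var)
  from sigma1_subst[OF assms, of "\<lambda>e. case_nat (e 0) (\<lambda>i. e (Suc (Suc i)))", OF this]
  show ?thesis by simp
qed

lemma sigma1_disj:
  assumes "sigma1 P" "sigma1 Q" shows "sigma1 (\<lambda>e. P e \<or> Q e)"
proof -
  obtain P' where P': "delta0 (\<lambda>e. P' (e 0) (\<lambda>i. e (Suc i)))" and P: "P = (\<lambda>e. \<exists>m. P' m e)"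
    using assms(1) by (rule sigma1E)
  obtain Q' where Q': "delta0 (\<lambda>e. Q' (e 0) (\<lambda>i. e (Suc i)))" and Q: "Q = (\<lambda>e. \<exists>m. Q' m e)"
    using assms(2) by (rule sigma1E)
  show ?thesis by (rule sigma1I[OF delta0_disj[OF P' Q']]) (auto simp: P Q)
qed

end

context rca0
begin

lemma bound2: "\<exists>b. m \<prec> b \<and> n \<prec> b"
  by (rule exI[of _ "(m \<oplus> n) \<oplus> \<one>"]) (simp add: less_add_one_iff)

text \<open>One unbounded witness has to serve both conjuncts. It is chosen as a strict upper bound,
  below which the two original witnesses are searched; \<open>sigma1_ex\<close> merges its two
  quantifiers in the same way.\<close>

lemma sigma1_conj:
  assumes "sigma1 P" "sigma1 Q" shows "sigma1 (\<lambda>e. P e \<and> Q e)"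
proof -
  obtain P' where P': "delta0 (\<lambda>e. P' (e 0) (\<lambda>i. e (Suc i)))" and P: "P = (\<lambda>e. \<exists>m. P' m e)"
    using assms(1) by (rule sigma1E)
  obtain Q' where Q': "delta0 (\<lambda>e. Q' (e 0) (\<lambda>i. e (Suc i)))" and Q: "Q = (\<lambda>e. \<exists>m. Q' m e)"
    using assms(2) by (rule sigma1E)
  have tm: "tm (\<lambda>e. case_nat (e 0) (\<lambda>i. e (Suc (Suc i))) i)" for i
    by (intro tm_case_nat tm_var)
  have "delta0 (\<lambda>e. P' (e 0) (\<lambda>i. e (Suc (Suc i))))" "delta0 (\<lambda>e. Q' (e 0) (\<lambda>i. e (Suc (Suc i))))"
    using delta0_subst[OF P', of "\<lambda>e. case_nat (e 0) (\<lambda>i. e (Suc (Suc i)))", OF tm]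
      delta0_subst[OF Q', of "\<lambda>e. case_nat (e 0) (\<lambda>i. e (Suc (Suc i)))", OF tm] by simp_all
  then have "delta0 (\<lambda>e. (\<exists>m. m \<prec> e 0 \<and> P' m (\<lambda>i. e (Suc i))) \<and> (\<exists>m. m \<prec> e 0 \<and> Q' m (\<lambda>i. e (Suc i))))"
    by (intro delta0_conj delta0_bex tm_var)
  then show ?thesis by (rule sigma1I) (use bound2 in \<open>auto simp: P Q\<close>, blast)
qed

lemma sigma1_ex:
  assumes "sigma1 (\<lambda>e. P (e 0) (\<lambda>i. e (Suc i)))" shows "sigma1 (\<lambda>e. \<exists>a. P a e)"
proof -
  obtain Q where Q: "delta0 (\<lambda>e. Q (e 0) (\<lambda>i. e (Suc i)))"
      and P: "(\<lambda>e. P (e 0) (\<lambda>i. e (Suc i))) = (\<lambda>e. \<exists>m. Q m e)"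
    using assms by (rule sigma1E)
  have P: "P a e \<longleftrightarrow> (\<exists>m. Q m (case_nat a e))" for a e
    using fun_cong[OF P, of "case_nat a e"] by simp
  let ?f = "\<lambda>e. case_nat (e 0) (case_nat (e (Suc 0)) (\<lambda>i. e (Suc (Suc (Suc i)))))"
  have "tm (\<lambda>e. ?f e i)" for i by (intro tm_case_nat tm_var)
  from delta0_subst[OF Q, of ?f, OF this]
  have "delta0 (\<lambda>e. Q (e 0) (case_nat (e (Suc 0)) (\<lambda>i. e (Suc (Suc (Suc i))))))" by simp
  then have "delta0 (\<lambda>e. \<exists>a. a \<prec> e 0 \<and> (\<exists>m. m \<prec> e 0 \<and> Q m (case_nat a (\<lambda>i. e (Suc i)))))"
    by (intro delta0_bex tm_var)
  then show ?thesis by (rule sigma1I) (use bound2 in \<open>auto simp: P\<close>, blast)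
qed

text \<open>The bounding principle, a consequence of \<open>\<Sigma>\<^sup>0\<^sub>1\<close>
  induction. It lets a bounded universal quantifier pass inside an existential one in
  \<open>sigma1_ball_tm\<close>.\<close>

lemma delta0_collection:
  assumes "delta0 (\<lambda>e. R (e 0) (e (Suc 0)))" "\<And>a. a \<prec> n \<Longrightarrow> \<exists>m. R m a"
  shows "\<exists>b. \<forall>a. a \<prec> n \<longrightarrow> (\<exists>m. m \<prec> b \<and> R m a)"
proof -
  \<comment> \<open>The guard \<open>a \<prec> n\<close> keeps the induction step valid for
    \<open>k\<close> beyond \<open>n\<close>, where no witnesses are assumed.\<close>
  let ?Q = "\<lambda>b k. \<forall>a. a \<prec> k \<longrightarrow> a \<prec> n \<longrightarrow> (\<exists>m. m \<prec> b \<and> R m a)"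
  have "\<exists>b. ?Q b n"
  proof (rule sigma_induct[where Q = ?Q and P = "\<lambda>k. \<exists>b. ?Q b k"])
    have "tm (\<lambda>e. case_nat (e 0) (\<lambda>_. e (Suc 0)) i)" for i by (intro tm_case_nat tm_var)
    from delta0_subst[OF assms(1), of "\<lambda>e. case_nat (e 0) (\<lambda>_. e (Suc 0))", OF this]
    have "delta0 (\<lambda>e. R (e 0) (e (Suc 0)))" by simp
    then show "delta0 (\<lambda>e. ?Q (e 0) (e (Suc 0)))" by (intro delta0_ball delta0_imp delta0_bex delta0_less tm_var tm_const)
  next
    fix k assume "\<exists>b. ?Q b k"
    then obtain b where b: "?Q b k" by blast
    show "\<exists>b. ?Q b (k \<oplus> \<one>)"
    proof (cases "k \<prec> n")
      case True
      then obtain m where m: "R m k" using assms(2) by blast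
      obtain b' where "b \<prec> b'" "m \<prec> b'" using bound2 by blast
      then have "\<exists>m. m \<prec> b' \<and> R m a" if "a \<prec> k \<oplus> \<one>" "a \<prec> n" for a
        using that b m ar.less_trans[of _ b b'] unfolding less_add_one by blast
      then show ?thesis by blast
    next
      case False
      with b show ?thesis by (auto simp: less_add_one)
    qed
  qed (use not_less_zero in auto)
  then show ?thesis by blast
qed

lemma sigma1_ball_tm:
  assumes "tm t" "sigma1 (\<lambda>e. P (e 0) (\<lambda>i. e (Suc i)))"
  shows "sigma1 (\<lambda>e. \<forall>a. a \<prec> t e \<longrightarrow> P a e)"
proof -
  obtain Q where Q: "delta0 (\<lambda>e. Q (e 0) (\<lambda>i. e (Suc i)))"
      and P: "(\<lambda>e. P (e 0) (\<lambda>i. e (Suc i))) = (\<lambda>e. \<exists>m. Q m e)"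
    using assms(2) by (rule sigma1E)
  have P: "P a e \<longleftrightarrow> (\<exists>m. Q m (case_nat a e))" for a e
    using fun_cong[OF P, of "case_nat a e"] by simp
  let ?f = "\<lambda>e. case_nat (e 0) (case_nat (e (Suc 0)) (\<lambda>i. e (Suc (Suc (Suc i)))))"
  have "tm (\<lambda>e. ?f e i)" for i by (intro tm_case_nat tm_var)
  from delta0_subst[OF Q, of ?f, OF this]
  have "delta0 (\<lambda>e. Q (e 0) (case_nat (e (Suc 0)) (\<lambda>i. e (Suc (Suc (Suc i))))))" by simp
  moreover have "tm (\<lambda>e. t (\<lambda>i. e (Suc i)))" by (rule tm_subst[OF assms(1)]) (rule tm_var)
  ultimately have *: "delta0 (\<lambda>e. \<forall>a. a \<prec> t (\<lambda>i. e (Suc i)) \<longrightarrow>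
      (\<exists>m. m \<prec> e 0 \<and> Q m (case_nat a (\<lambda>i. e (Suc i)))))"
    by (intro delta0_ball delta0_bex tm_var)
  have "(\<forall>a. a \<prec> n \<longrightarrow> (\<exists>m. Q m (case_nat a e))) \<longleftrightarrow>
      (\<exists>b. \<forall>a. a \<prec> n \<longrightarrow> (\<exists>m. m \<prec> b \<and> Q m (case_nat a e)))" for n e
  proof -
    have "tm (\<lambda>e'. case_nat (e' 0) (case_nat (e' (Suc 0)) e) i)" for i
      by (intro tm_case_nat tm_var tm_const)
    from delta0_subst[OF Q, of "\<lambda>e'. case_nat (e' 0) (case_nat (e' (Suc 0)) e)", OF this]
    have "delta0 (\<lambda>e'. Q (e' 0) (case_nat (e' (Suc 0)) e))" by simp
    from delta0_collection[OF this, of n] show ?thesis by blast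
  qed
  then show ?thesis by (intro sigma1I[OF *]) (simp add: P)
qed

lemma sigma1_let:
  assumes "recfn f" "sigma1 (\<lambda>e. P (e 0) (\<lambda>i. e (Suc i)))"
  shows "sigma1 (\<lambda>e. P (f e) e)"
  using sigma1_ex[OF sigma1_conj[OF assms(1)[unfolded recfn_def] assms(2)]] by simp

lemma recfn_tm:
  assumes "tm t" shows "recfn t"
proof -
  have "tm (\<lambda>e. t (\<lambda>i. e (Suc i)))" by (rule tm_subst[OF assms]) (rule tm_var)
  then show ?thesis unfolding recfn_def by (intro sigma1_delta0 delta0_eq tm_var)
qed

lemma recfn_subst:
  assumes "recfn g" "\<And>i. tm (\<lambda>e. f e i)"
  shows "recfn (\<lambda>e. g (f e))"
proof -
  let ?f = "\<lambda>e. case_nat (e 0) (f (\<lambda>i. e (Suc i)))"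
  have "tm (\<lambda>e. ?f e i)" for i
    by (intro tm_case_nat tm_var tm_subst[OF assms(2)])
  from sigma1_subst[OF assms(1)[unfolded recfn_def], of ?f, OF this] show ?thesis
    unfolding recfn_def by simp
qed

lemma recfn_shift: "recfn f \<Longrightarrow> recfn (\<lambda>e. f (\<lambda>i. e (Suc i)))"
  by (rule recfn_subst) (auto intro: tm_var)

lemma recfn_let:
  assumes "recfn f" "recfn (\<lambda>e. F (e 0) (\<lambda>i. e (Suc i)))"
  shows "recfn (\<lambda>e. F (f e) e)"
proof -
  let ?f = "\<lambda>e. case_nat (e (Suc 0)) (case_nat (e 0) (\<lambda>i. e (Suc (Suc i))))"
  have "tm (\<lambda>e. ?f e i)" for i by (intro tm_case_nat tm_var)
  from sigma1_subst[OF assms(2)[unfolded recfn_def], of ?f, OF this]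
  have "sigma1 (\<lambda>e. e (Suc 0) = F (e 0) (\<lambda>i. e (Suc (Suc i))))" by simp
  then show ?thesis unfolding recfn_def by (rule sigma1_let[OF recfn_shift[OF assms(1)]])
qed

lemma sigma1_ball:
  assumes "recfn t" "sigma1 (\<lambda>e. P (e 0) (\<lambda>i. e (Suc i)))"
  shows "sigma1 (\<lambda>e. \<forall>a. a \<prec> t e \<longrightarrow> P a e)"
  by (rule sigma1_let[OF assms(1)]) (rule sigma1_ball_tm[OF tm_var sigma1_shift1[OF assms(2)]])

lemma delta1_let:
  "recfn f \<Longrightarrow> delta1 (\<lambda>e. P (e 0) (\<lambda>i. e (Suc i))) \<Longrightarrow> delta1 (\<lambda>e. P (f e) e)"
  unfolding delta1_def using sigma1_let[of f P] sigma1_let[of f "\<lambda>a e. \<not> P a e"] by blast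

lemma delta1_shift: "delta1 P \<Longrightarrow> delta1 (\<lambda>e. P (\<lambda>i. e (Suc i)))"
  unfolding delta1_def using sigma1_shift by blast

lemma delta1_delta0: "delta0 P \<Longrightarrow> delta1 P"
  unfolding delta1_def using sigma1_delta0 delta0_not by blast

lemma sigma1_delta1: "delta1 P \<Longrightarrow> sigma1 P"
  unfolding delta1_def by blast

lemma delta1_subst:
  assumes "delta1 P" and f: "\<And>i. tm (\<lambda>e. f e i)"
  shows "delta1 (\<lambda>e. P (f e))"
  using assms sigma1_subst[of P f] sigma1_subst[of "\<lambda>e. \<not> P e" f] unfolding delta1_def by blast

lemma delta1_rel1:
  assumes "delta1 (\<lambda>e. R (e 0))" "recfn f"
  shows "delta1 (\<lambda>e. R (f e))"
  by (rule delta1_let[OF assms(2)]) (rule assms(1))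

text \<open>Reduces the definability of a relation between recursive functions to the case of two
  variables, so that unfolding a definition never has to carry arbitrary \<open>f\<close> and
  \<open>g\<close> under quantifiers.\<close>

lemma delta1_rel2:
  assumes "delta1 (\<lambda>e. R (e 0) (e (Suc 0)))" "recfn f" "recfn g"
  shows "delta1 (\<lambda>e. R (f e) (g e))"
proof -
  have "tm (\<lambda>e. case_nat (e (Suc 0)) (\<lambda>_. e 0) i)" for i by (intro tm_case_nat tm_var)
  from delta1_subst[OF assms(1), of "\<lambda>e. case_nat (e (Suc 0)) (\<lambda>_. e 0)", OF this]
  have "delta1 (\<lambda>e. R (e (Suc 0)) (e 0))" by simp
  then have "delta1 (\<lambda>e. R (e 0) (g (\<lambda>i. e (Suc i))))"
    by (rule delta1_let[OF recfn_shift[OF assms(3)]])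
  then show ?thesis by (rule delta1_let[OF assms(2)])
qed

lemma recfn_fun1:
  assumes "recfn (\<lambda>e. F (e 0))" "recfn f"
  shows "recfn (\<lambda>e. F (f e))"
  by (rule recfn_let[OF assms(2)]) (rule assms(1))

lemma recfn_fun2:
  assumes "recfn (\<lambda>e. F (e 0) (e (Suc 0)))" "recfn f" "recfn g"
  shows "recfn (\<lambda>e. F (f e) (g e))"
proof -
  have "tm (\<lambda>e. case_nat (e (Suc 0)) (\<lambda>_. e 0) i)" for i by (intro tm_case_nat tm_var)
  from recfn_subst[OF assms(1), of "\<lambda>e. case_nat (e (Suc 0)) (\<lambda>_. e 0)", OF this]
  have "recfn (\<lambda>e. F (e (Suc 0)) (e 0))" by simp
  then have "recfn (\<lambda>e. F (e 0) (g (\<lambda>i. e (Suc i))))"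
    by (rule recfn_let[OF recfn_shift[OF assms(3)]])
  then show ?thesis by (rule recfn_let[OF assms(2)])
qed

lemma recfn_var: "recfn (\<lambda>e. e i)" and recfn_const: "recfn (\<lambda>e. c)"
  by (intro recfn_tm tm.intros)+

lemma recfn_add: "recfn f \<Longrightarrow> recfn g \<Longrightarrow> recfn (\<lambda>e. f e \<oplus> g e)"
  and recfn_mult: "recfn f \<Longrightarrow> recfn g \<Longrightarrow> recfn (\<lambda>e. f e \<otimes> g e)"
  by (erule (1) recfn_fun2[rotated], intro recfn_tm tm.intros)+

lemma delta1_eq: "recfn f \<Longrightarrow> recfn g \<Longrightarrow> delta1 (\<lambda>e. f e = g e)"
  and delta1_less: "recfn f \<Longrightarrow> recfn g \<Longrightarrow> delta1 (\<lambda>e. f e \<prec> g e)"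
  by (erule (1) delta1_rel2[rotated], intro delta1_delta0 delta0_intros)+

lemma delta1_mem: "recfn f \<Longrightarrow> X \<in> Sets M \<Longrightarrow> delta1 (\<lambda>e. f e \<in> X)"
  by (erule delta1_rel1[rotated], intro delta1_delta0 delta0_intros)

lemma delta1_not: "delta1 P \<Longrightarrow> delta1 (\<lambda>e. \<not> P e)"
  unfolding delta1_def by simp

lemma delta1_conj: "delta1 P \<Longrightarrow> delta1 Q \<Longrightarrow> delta1 (\<lambda>e. P e \<and> Q e)"
  unfolding delta1_def de_Morgan_conj by (elim conjE, intro conjI sigma1_conj sigma1_disj)

lemma delta1_disj: "delta1 P \<Longrightarrow> delta1 Q \<Longrightarrow> delta1 (\<lambda>e. P e \<or> Q e)"
  unfolding delta1_def de_Morgan_disj by (elim conjE, intro conjI sigma1_conj sigma1_disj)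

lemma delta1_imp: "delta1 P \<Longrightarrow> delta1 Q \<Longrightarrow> delta1 (\<lambda>e. P e \<longrightarrow> Q e)"
  unfolding imp_conv_disj by (intro delta1_disj delta1_not)

lemma delta1_iff: "delta1 P \<Longrightarrow> delta1 Q \<Longrightarrow> delta1 (\<lambda>e. P e \<longleftrightarrow> Q e)"
  unfolding iff_conv_conj_imp by (intro delta1_conj delta1_imp)

lemma delta1_leq: "recfn f \<Longrightarrow> recfn g \<Longrightarrow> delta1 (\<lambda>e. f e \<preceq> g e)"
  unfolding leq_def by (intro delta1_disj delta1_less delta1_eq)

lemma sigma1_bex:
  assumes "recfn t" "sigma1 (\<lambda>e. P (e 0) (\<lambda>i. e (Suc i)))"
  shows "sigma1 (\<lambda>e. \<exists>a. a \<prec> t e \<and> P a e)"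
  by (intro sigma1_ex sigma1_conj sigma1_delta1[OF delta1_less] recfn_var recfn_shift[OF assms(1)] assms(2))

lemma delta1_bex:
  assumes "recfn t" "delta1 (\<lambda>e. P (e 0) (\<lambda>i. e (Suc i)))"
  shows "delta1 (\<lambda>e. \<exists>a. a \<prec> t e \<and> P a e)"
  using sigma1_bex[OF assms(1), of P] sigma1_ball[OF assms(1), of "\<lambda>a e. \<not> P a e"] assms(2)
  unfolding delta1_def by simp

lemma delta1_ball:
  assumes "recfn t" "delta1 (\<lambda>e. P (e 0) (\<lambda>i. e (Suc i)))"
  shows "delta1 (\<lambda>e. \<forall>a. a \<prec> t e \<longrightarrow> P a e)"
  using sigma1_bex[OF assms(1), of "\<lambda>a e. \<not> P a e"] sigma1_ball[OF assms(1), of P] assms(2)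
  unfolding delta1_def by simp

lemmas delta1_intros = recfn_var recfn_const recfn_add recfn_mult delta1_eq delta1_less delta1_mem
  delta1_not delta1_conj delta1_disj delta1_imp delta1_iff delta1_leq delta1_bex delta1_ball

section \<open>Induction, comprehension and extremal elements for definable predicates\<close>

lemma sigma1_induct [case_names zero step sigma1]:
  assumes "P \<zero>" "\<And>n. P n \<Longrightarrow> P (n \<oplus> \<one>)" "sigma1 (\<lambda>e. P (e 0))"
  shows "P n"
proof -
  obtain Q where Q: "delta0 (\<lambda>e. Q (e 0) (\<lambda>i. e (Suc i)))" and P: "(\<lambda>e. P (e 0)) = (\<lambda>e. \<exists>m. Q m e)"
    using assms(3) by (rule sigma1E)
  show ?thesis
  proof (rule sigma_induct[where Q = "\<lambda>m n. Q m (\<lambda>_. n)"])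
    have "tm (\<lambda>e. case_nat (e 0) (\<lambda>_. e (Suc 0)) i)" for i by (intro tm_case_nat tm_var)
    from delta0_subst[OF Q, of "\<lambda>e. case_nat (e 0) (\<lambda>_. e (Suc 0))", OF this]
    show "delta0 (\<lambda>e. Q (e 0) (\<lambda>_. e (Suc 0)))" by simp
    show "P n \<longleftrightarrow> (\<exists>m. Q m (\<lambda>_. n))" for n using fun_cong[OF P, of "\<lambda>_. n"] by simp
  qed (use assms in auto)
qed

lemma delta1_induct [case_names zero step delta1]:
  assumes "P \<zero>" "\<And>n. P n \<Longrightarrow> P (n \<oplus> \<one>)" "delta1 (\<lambda>e. P (e 0))"
  shows "P n"
  by (rule sigma1_induct) (use assms sigma1_delta1 in auto)

lemma delta1_comprehension:
  assumes "delta1 (\<lambda>e. P (e 0))"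
  shows "{n. P n} \<in> Sets M"
proof -
  have P: "sigma1 (\<lambda>e. P (e 0))" and N: "sigma1 (\<lambda>e. \<not> P (e 0))"
    using assms unfolding delta1_def by auto
  obtain Q where Q: "delta0 (\<lambda>e. Q (e 0) (\<lambda>i. e (Suc i)))" and PQ: "(\<lambda>e. P (e 0)) = (\<lambda>e. \<exists>m. Q m e)"
    using P by (rule sigma1E)
  obtain R where R: "delta0 (\<lambda>e. R (e 0) (\<lambda>i. e (Suc i)))" and PR: "(\<lambda>e. \<not> P (e 0)) = (\<lambda>e. \<exists>m. R m e)"
    using N by (rule sigma1E)
  have tm: "tm (\<lambda>e. case_nat (e 0) (\<lambda>_. e (Suc 0)) i)" for i by (intro tm_case_nat tm_var)
  show ?thesis
  proof (rule comprehension[where Q = "\<lambda>m n. Q m (\<lambda>_. n)" and R = "\<lambda>m n. R m (\<lambda>_. n)"])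
    show "delta0 (\<lambda>e. Q (e 0) (\<lambda>_. e (Suc 0)))" "delta0 (\<lambda>e. R (e 0) (\<lambda>_. e (Suc 0)))"
      using delta0_subst[OF Q, of "\<lambda>e. case_nat (e 0) (\<lambda>_. e (Suc 0))", OF tm]
        delta0_subst[OF R, of "\<lambda>e. case_nat (e 0) (\<lambda>_. e (Suc 0))", OF tm] by simp_all
    show "P n \<longleftrightarrow> (\<exists>m. Q m (\<lambda>_. n))" "\<not> P n \<longleftrightarrow> (\<exists>m. R m (\<lambda>_. n))" for n
      using fun_cong[OF PQ, of "\<lambda>_. n"] fun_cong[OF PR, of "\<lambda>_. n"] by simp_all
  qed
qed

text \<open>Without a least element, induction on \<open>l\<close> shows that nothing below
  \<open>l\<close> satisfies \<open>P\<close>. The complement of \<open>P\<close> occurs in this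
  statement, so it too has to be \<open>\<Sigma>\<^sup>0\<^sub>1\<close>.\<close>

lemma delta1_least:
  assumes "delta1 (\<lambda>e. P (e 0))" "P n"
  shows "\<exists>m. P m \<and> (\<forall>k. k \<prec> m \<longrightarrow> \<not> P k)"
proof (rule ccontr)
  assume least: "\<not> ?thesis"
  have "\<forall>k. k \<prec> l \<longrightarrow> \<not> P k" for l
  proof (induct l rule: delta1_induct)
    case zero then show ?case by (simp add: not_less_zero)
  next
    case (step n)
    then show ?case using least by (auto simp: less_add_one)
  next
    case delta1
    show ?case by (intro delta1_intros delta1_rel1[OF assms(1)])
  qed
  from this[of "n \<oplus> \<one>"] assms(2) show False by (auto simp: less_add_one)
qed

text \<open>Without a greatest element, elements of \<open>P\<close> climb past every
  \<open>l\<close>, and hence past \<open>b\<close>. In this induction \<open>P\<close> occurs only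
  positively, so a \<open>\<Sigma>\<^sup>0\<^sub>1\<close> predicate suffices, in contrast to least
  elements.\<close>

lemma sigma1_greatest:
  assumes "sigma1 (\<lambda>e. P (e 0))" "P a" "\<And>n. P n \<Longrightarrow> n \<preceq> b"
  shows "\<exists>m. P m \<and> (\<forall>n. P n \<longrightarrow> n \<preceq> m)"
proof (rule ccontr)
  assume max: "\<not> ?thesis"
  have "\<exists>v. P v \<and> l \<preceq> v" for l
  proof (induct l rule: sigma1_induct)
    case zero then show ?case using assms(2) by auto
  next
    case (step n)
    then obtain v where v: "P v" "n \<preceq> v" by blast
    then obtain w where "P w" "v \<prec> w" using max by (auto simp: ar.not_le)
    then show ?case using v(2) by (metis add_one_leq_iff ar.le_less_trans)
  next
    case sigma1
    show ?case
      by (intro sigma1_ex sigma1_conj assms(1) sigma1_delta1[OF delta1_leq] recfn_var)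
  qed
  from this[of "b \<oplus> \<one>"] show False using assms(3) by (metis add_one_leq_iff ar.not_le)
qed

end

section \<open>Codes of finite sets\<close>

context rca0
begin

lemma recfn_if:
  assumes "delta1 P" "recfn f" "recfn g"
  shows "recfn (\<lambda>e. if P e then f e else g e)"
proof -
  have "sigma1 (\<lambda>e. (P (\<lambda>i. e (Suc i)) \<and> e 0 = f (\<lambda>i. e (Suc i)))
      \<or> (\<not> P (\<lambda>i. e (Suc i)) \<and> e 0 = g (\<lambda>i. e (Suc i))))"
    by (intro sigma1_disj sigma1_conj sigma1_delta1 delta1_not delta1_shift assms(1)
        assms(2,3)[unfolded recfn_def])
  then show ?thesis unfolding recfn_def by (rule back_subst[of sigma1]) auto
qed

lemma recfn_maximum: "recfn f \<Longrightarrow> recfn g \<Longrightarrow> recfn (\<lambda>e. maximum (f e) (g e))"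
  unfolding maximum_def by (intro recfn_if delta1_less)

lemma recfn_pair: "recfn f \<Longrightarrow> recfn g \<Longrightarrow> recfn (\<lambda>e. pair (f e) (g e))"
  unfolding pair_def by (intro recfn_add recfn_mult)

lemma divides_dvd: "divides = dvd.dvd (\<otimes>)"
  by (simp add: fun_eq_iff divides_def dvd.dvd_def)

lemma leq_square: "a \<preceq> a \<otimes> a"
proof -
  consider "a = \<zero>" | k where "a = k \<oplus> \<one>" using zero_or_add_one by blast
  then show ?thesis by cases (simp_all add: mult_add_one)
qed

text \<open>A bound on the quotient makes divisibility \<open>\<Delta>\<^sup>0\<^sub>1\<close>. The
  analogous lemmas for \<open>elts\<close>, \<open>triple\<close>, \<open>set_code\<close> and
  \<open>fin_seq\<close> bound their quantifiers for the same purpose.\<close>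

lemma divides_bounded: "divides a b \<longleftrightarrow> (\<exists>k. k \<prec> b \<oplus> \<one> \<and> b = a \<otimes> k)"
proof
  assume "divides a b"
  then obtain k where k: "b = a \<otimes> k" unfolding divides_def by blast
  show "\<exists>k. k \<prec> b \<oplus> \<one> \<and> b = a \<otimes> k"
  proof (cases "a = \<zero>")
    case True
    \<comment> \<open>For \<open>a = \<zero>\<close> also \<open>b = \<zero>\<close>, and the given
      quotient may be arbitrarily large; \<open>\<zero>\<close> is one within the bound.\<close>
    then show ?thesis using k by (intro exI[of _ \<zero>]) (simp add: zero_less_add_one)
  next
    case False
    then obtain j where "a = j \<oplus> \<one>" using zero_or_add_one by blast
    then have "k \<preceq> b" by (simp add: k add_one_mult)
    then show ?thesis using k less_add_one_iff by blast
  qed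
qed (auto simp: divides_def)

lemma delta1_divides: "recfn f \<Longrightarrow> recfn g \<Longrightarrow> delta1 (\<lambda>e. divides (f e) (g e))"
  by (erule (1) delta1_rel2[where R = divides, rotated]) (unfold divides_bounded, intro delta1_intros)

text \<open>The codes of pairs with sum \<open>s\<close> lie between the square of \<open>s\<close>
  and that square plus \<open>s\<close>, which is still below the square of
  \<open>s \<oplus> \<one>\<close>. So the code determines the sum.\<close>

lemma pair_less:
  assumes "i \<oplus> j \<prec> i' \<oplus> j'" shows "pair i j \<prec> pair i' j'"
proof -
  define s where "s = i \<oplus> j"
  have "s \<oplus> \<one> \<preceq> i' \<oplus> j'" using assms by (simp add: s_def add_one_leq_iff)
  then have *: "(s \<oplus> \<one>) \<otimes> (s \<oplus> \<one>) \<preceq> (i' \<oplus> j') \<otimes> (i' \<oplus> j')" by (intro ar.mult_mono) auto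
  have "i \<preceq> s" by (simp add: s_def)
  then have "s \<otimes> s \<oplus> i \<preceq> s \<otimes> s \<oplus> s" by (rule ar.add_left_mono)
  also have "\<dots> \<preceq> s \<otimes> s \<oplus> s \<oplus> s" by simp
  also have "\<dots> \<prec> (s \<oplus> \<one>) \<otimes> (s \<oplus> \<one>)"
    by (simp add: mult_add_one add_one_mult less_add_one_iff flip: add_assoc)
  also note *
  also have "(i' \<oplus> j') \<otimes> (i' \<oplus> j') \<preceq> pair i' j'" by (simp add: pair_def)
  finally show ?thesis by (simp add: pair_def s_def)
qed

lemma pair_inject [simp]: "pair i j = pair i' j' \<longleftrightarrow> i = i' \<and> j = j'"
proof
  assume eq: "pair i j = pair i' j'"
  then have s: "i \<oplus> j = i' \<oplus> j'" using pair_less linear less_irrefl by metis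
  with eq have i: "i = i'" unfolding pair_def by simp
  with s show "i = i' \<and> j = j'" by simp
qed simp

lemma leq_pair1: "i \<preceq> pair i j"
  by (simp add: pair_def)

lemma leq_pair2: "j \<preceq> pair i j"
proof -
  have "j \<preceq> i \<oplus> j" by simp
  also have "\<dots> \<preceq> (i \<oplus> j) \<otimes> (i \<oplus> j)" by (rule leq_square)
  also have "\<dots> \<preceq> pair i j" by (simp add: pair_def)
  finally show ?thesis .
qed

lemma elts_pair: "elts (pair k (pair m n)) = beta_set k m n"
  by (auto simp: elts_def)

lemma elts_less: "i \<in> elts c \<Longrightarrow> i \<prec> c"
  by (auto simp: elts_def beta_set_def intro: ar.less_le_trans leq_pair1)

lemma pair_elts_less: "pair i j \<in> elts c \<Longrightarrow> i \<prec> c" "pair i j \<in> elts c \<Longrightarrow> j \<prec> c"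
  using elts_less leq_pair1 leq_pair2 ar.le_less_trans by blast+

lemma leq_triple:
  "k \<preceq> pair k (pair m n)" "m \<preceq> pair k (pair m n)" "n \<preceq> pair k (pair m n)"
  using leq_pair1 leq_pair2 ar.order_trans by blast+

lemma elts_bounded: "i \<in> elts c \<longleftrightarrow> (\<exists>k. k \<prec> c \<oplus> \<one> \<and> (\<exists>m. m \<prec> c \<oplus> \<one> \<and> (\<exists>n. n \<prec> c \<oplus> \<one> \<and>
    c = pair k (pair m n) \<and> i \<prec> k \<and> divides (m \<otimes> (i \<oplus> \<one>) \<oplus> \<one>) n)))"
  unfolding elts_def beta_set_def less_add_one_iff mem_Collect_eq using leq_triple by blast

lemma delta1_elts: "recfn f \<Longrightarrow> recfn g \<Longrightarrow> delta1 (\<lambda>e. f e \<in> elts (g e))"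
  by (erule (1) delta1_rel2[where R = "\<lambda>i c. i \<in> elts c", rotated])
    (unfold elts_bounded, intro delta1_intros delta1_divides recfn_pair)

text \<open>A number \<open>m\<close> as in the beta function lemma: the moduli \<open>m (i + 1) + 1\<close>, \<open>i < k\<close>, are coprime.\<close>

lemma common_multiple: "\<exists>m. m \<noteq> \<zero> \<and> (\<forall>d. d \<prec> k \<longrightarrow> d \<noteq> \<zero> \<longrightarrow> divides d m)"
proof (induct k rule: sigma1_induct)
  case zero then show ?case by (intro exI[of _ \<one>]) (simp add: not_less_zero)
next
  case (step k)
  then obtain m where m: "m \<noteq> \<zero>" "\<And>d. d \<prec> k \<Longrightarrow> d \<noteq> \<zero> \<Longrightarrow> divides d m" by blast
  show ?case
  proof (cases "k = \<zero>")
    case True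
    then show ?thesis using m unfolding less_add_one by blast
  next
    case False
    then show ?thesis using m by (intro exI[of _ "m \<otimes> k"]) (auto simp: less_add_one divides_dvd)
  qed
next
  case sigma1
  show ?case by (intro sigma1_ex sigma1_delta1 delta1_intros delta1_divides)
qed

text \<open>The modulus divides both \<open>x \<otimes> m \<otimes> u\<close> and
  \<open>x \<otimes> m \<otimes> u \<oplus> x\<close>, hence the difference
  \<open>x\<close>.\<close>

lemma dvd_cancel:
  assumes "divides (m \<otimes> u \<oplus> \<one>) (x \<otimes> m)" shows "divides (m \<otimes> u \<oplus> \<one>) x"
proof -
  have "divides (m \<otimes> u \<oplus> \<one>) (x \<otimes> m \<otimes> u)" using assms by (simp add: divides_dvd)
  moreover have "divides (m \<otimes> u \<oplus> \<one>) (x \<otimes> m \<otimes> u \<oplus> x)"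
  proof -
    have "x \<otimes> m \<otimes> u \<oplus> x = (m \<otimes> u \<oplus> \<one>) \<otimes> x"
      by (simp only: distrib_left mult_one mult_assoc mult_commute mult_left_commute)
    then show ?thesis by (simp add: divides_dvd)
  qed
  ultimately show ?thesis by (simp add: divides_dvd ar.dvd_add_right_iff)
qed

text \<open>Coprimality is phrased as cancelling one modulus from a multiple of another. Two moduli
  differ by \<open>m\<close> times some nonzero \<open>d \<prec> k\<close>, and \<open>d\<close>
  divides \<open>m\<close>; so the modulus of \<open>i\<close> divides
  \<open>n \<otimes> m \<otimes> m\<close>, from which \<open>m\<close> is cancelled twice.\<close>

lemma moduli_coprime:
  assumes m: "\<And>d. d \<prec> k \<Longrightarrow> d \<noteq> \<zero> \<Longrightarrow> divides d m" and k: "i \<prec> k" "j \<prec> k" and "i \<noteq> j"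
    and dvd: "divides (m \<otimes> (i \<oplus> \<one>) \<oplus> \<one>) (n \<otimes> (m \<otimes> (j \<oplus> \<one>) \<oplus> \<one>))"
  shows "divides (m \<otimes> (i \<oplus> \<one>) \<oplus> \<one>) n"
proof -
  let ?a = "m \<otimes> (i \<oplus> \<one>) \<oplus> \<one>" and ?b = "m \<otimes> (j \<oplus> \<one>) \<oplus> \<one>"
  have self: "divides ?a (n \<otimes> ?a)" by (simp add: divides_dvd)
  obtain d where d: "d \<prec> k" "d \<noteq> \<zero>" "divides ?a (n \<otimes> m \<otimes> d)"
  proof -
    consider "i \<prec> j" | "j \<prec> i" using linear \<open>i \<noteq> j\<close> by blast
    then show thesis
    proof cases
      case 1
      then obtain d where j: "j = i \<oplus> (d \<oplus> \<one>)" using less_iff_add by blast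
      have "n \<otimes> ?b = n \<otimes> ?a \<oplus> n \<otimes> m \<otimes> (d \<oplus> \<one>)"
        unfolding j by (simp only: distrib_left mult_assoc add_assoc add_commute add_left_commute mult_one)
      with dvd self have "divides ?a (n \<otimes> m \<otimes> (d \<oplus> \<one>))"
        by (metis divides_dvd ar.dvd_add_right_iff)
      moreover have "d \<oplus> \<one> \<preceq> j" by (simp add: j)
      ultimately show thesis using that k(2) add_one_neq_zero ar.le_less_trans by blast
    next
      case 2
      then obtain d where i: "i = j \<oplus> (d \<oplus> \<one>)" using less_iff_add by blast
      have "n \<otimes> ?a = n \<otimes> ?b \<oplus> n \<otimes> m \<otimes> (d \<oplus> \<one>)"
        unfolding i by (simp only: distrib_left mult_assoc add_assoc add_commute add_left_commute mult_one)
      with dvd self have "divides ?a (n \<otimes> m \<otimes> (d \<oplus> \<one>))"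
        by (metis divides_dvd ar.dvd_add_right_iff)
      moreover have "d \<oplus> \<one> \<preceq> i" by (simp add: i)
      ultimately show thesis using that k(1) add_one_neq_zero ar.le_less_trans by blast
    qed
  qed
  obtain q where q: "m = d \<otimes> q" using m[OF d(1,2)] unfolding divides_def by blast
  have "divides ?a (n \<otimes> m \<otimes> d \<otimes> q)" using d(3) by (simp add: divides_dvd)
  also have "n \<otimes> m \<otimes> d \<otimes> q = n \<otimes> m \<otimes> m" by (simp only: mult_assoc flip: q)
  finally show ?thesis by - (rule dvd_cancel, rule dvd_cancel)
qed

text \<open>The number \<open>n\<close> is the product of the moduli of the members of
  \<open>X\<close> below \<open>k\<close>. It is accumulated one factor at a time, with the partial
  product hidden in the existential quantifier of the induction statement.\<close>

lemma beta_set_exists: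
  assumes X: "delta1 (\<lambda>e. X (e 0))"
  shows "\<exists>m n. beta_set k m n = {i. i \<prec> k \<and> X i}"
proof -
  obtain m where m: "m \<noteq> \<zero>" "\<And>d. d \<prec> k \<Longrightarrow> d \<noteq> \<zero> \<Longrightarrow> divides d m"
    using common_multiple by blast
  let ?a = "\<lambda>i. m \<otimes> (i \<oplus> \<one>) \<oplus> \<one>"
  have "\<exists>n. \<forall>i. i \<prec> k \<longrightarrow> (divides (?a i) n \<longleftrightarrow> i \<prec> j \<and> X i)" for j
  proof (induct j rule: sigma1_induct)
    case zero
    \<comment> \<open>The empty product \<open>\<one>\<close> codes the empty set because
      \<open>m\<close> is nonzero and so every modulus exceeds \<open>\<one>\<close>.\<close>
    have "\<not> divides (?a i) \<one>" for i
    proof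
      assume "divides (?a i) \<one>"
      then obtain q where "\<one> = ?a i \<otimes> q" unfolding divides_def by blast
      moreover have "q \<noteq> \<zero>" using calculation by auto
      ultimately have "?a i \<preceq> \<one>" by (metis zero_or_add_one mult_add_one zero_leq ar.le_add_same_cancel2)
      then have "m \<otimes> (i \<oplus> \<one>) \<preceq> \<zero>" by (simp only: ar.add_le_same_cancel2)
      then have "m \<otimes> (i \<oplus> \<one>) = \<zero>" using zero_leq by (rule ar.order_antisym)
      then show False using m(1) add_one_neq_zero by simp
    qed
    then show ?case using not_less_zero by blast
  next
    case (step j)
    then obtain n where n: "\<And>i. i \<prec> k \<Longrightarrow> divides (?a i) n \<longleftrightarrow> i \<prec> j \<and> X i" by blast
    show ?case
    proof (cases "j \<prec> k \<and> X j")
      case True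
      have "divides (?a i) (n \<otimes> ?a j) \<longleftrightarrow> i \<prec> j \<oplus> \<one> \<and> X i" if i: "i \<prec> k" for i
      proof (cases "i = j")
        case True
        then show ?thesis using \<open>j \<prec> k \<and> X j\<close> by (simp add: divides_dvd less_add_one)
      next
        case False
        have "j \<prec> k" using True by blast
        have "divides (?a i) (n \<otimes> ?a j) \<longleftrightarrow> divides (?a i) n"
        proof
          show "divides (?a i) (n \<otimes> ?a j) \<Longrightarrow> divides (?a i) n"
            by (rule moduli_coprime[OF m(2) i \<open>j \<prec> k\<close> False])
        qed (simp add: divides_dvd)
        then show ?thesis using n[OF i] False by (simp add: less_add_one)
      qed
      then show ?thesis by blast
    next
      case False
      then show ?thesis using n by (intro exI[of _ n]) (auto simp: less_add_one)
    qed
  next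
    case sigma1
    show ?case
      by (intro sigma1_ex sigma1_delta1 delta1_intros delta1_divides delta1_rel1[OF X])
  qed
  from this[of k] obtain n where "\<forall>i. i \<prec> k \<longrightarrow> (divides (?a i) n \<longleftrightarrow> i \<prec> k \<and> X i)" by blast
  then have "beta_set k m n = {i. i \<prec> k \<and> X i}" by (auto simp: beta_set_def)
  then show ?thesis by blast
qed

section \<open>Least codes of finite sets\<close>

definition triple :: "'m \<Rightarrow> bool" where
  "triple c \<longleftrightarrow> (\<exists>k m n. c = pair k (pair m n))"

lemma triple_bounded: "triple c \<longleftrightarrow>
    (\<exists>k. k \<prec> c \<oplus> \<one> \<and> (\<exists>m. m \<prec> c \<oplus> \<one> \<and> (\<exists>n. n \<prec> c \<oplus> \<one> \<and> c = pair k (pair m n))))"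
  unfolding triple_def less_add_one_iff using leq_triple by blast

lemma delta1_triple: "recfn f \<Longrightarrow> delta1 (\<lambda>e. triple (f e))"
  by (erule delta1_rel1[where R = triple, rotated])
    (unfold triple_bounded, intro delta1_intros recfn_pair)

lemma set_code_iff: "set_code c \<longleftrightarrow> triple c \<and> (\<forall>d. triple d \<and> elts d = elts c \<longrightarrow> c \<preceq> d)"
  unfolding set_code_def triple_def using elts_pair by auto

lemma set_code_unique: "set_code c \<Longrightarrow> set_code d \<Longrightarrow> elts c = elts d \<Longrightarrow> c = d"
  unfolding set_code_iff by (metis ar.order_antisym)

text \<open>Only codes \<open>d\<close> smaller than \<open>c\<close> can violate minimality, and
  for these all elements of \<open>d\<close> and of \<open>c\<close> lie below
  \<open>c\<close>.\<close>

lemma set_code_bounded: "set_code c \<longleftrightarrow> triple c \<and>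
    (\<forall>d. d \<prec> c \<longrightarrow> triple d \<longrightarrow> \<not> (\<forall>i. i \<prec> c \<longrightarrow> (i \<in> elts d \<longleftrightarrow> i \<in> elts c)))"
proof -
  have "d \<prec> c \<Longrightarrow> elts d = elts c \<longleftrightarrow> (\<forall>i. i \<prec> c \<longrightarrow> (i \<in> elts d \<longleftrightarrow> i \<in> elts c))" for d
    using elts_less ar.less_trans by blast
  then show ?thesis unfolding set_code_iff by (metis ar.not_le)
qed

lemma delta1_set_code: "recfn f \<Longrightarrow> delta1 (\<lambda>e. set_code (f e))"
  by (erule delta1_rel1[where R = set_code, rotated])
    (unfold set_code_bounded, intro delta1_intros delta1_triple delta1_elts)

lemma set_code_exists:
  assumes X: "delta1 (\<lambda>e. X (e 0))" and k: "\<And>i. X i \<Longrightarrow> i \<prec> k"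
  shows "\<exists>c. set_code c \<and> elts c = Collect X"
proof -
  \<comment> \<open>The equation \<open>elts c = Collect X\<close> is written with bounded
    quantifiers, elements of \<open>c\<close> being below \<open>c\<close> and those of
    \<open>X\<close> below \<open>k\<close>; this puts it within reach of
    \<open>delta1_least\<close>.\<close>
  let ?C = "\<lambda>c. triple c \<and> (\<forall>i. i \<prec> c \<longrightarrow> i \<in> elts c \<longrightarrow> X i) \<and> (\<forall>i. i \<prec> k \<longrightarrow> X i \<longrightarrow> i \<in> elts c)"
  have C: "?C c \<longleftrightarrow> triple c \<and> elts c = Collect X" for c
    using k elts_less by blast
  obtain m n where "beta_set k m n = {i. i \<prec> k \<and> X i}" using beta_set_exists[OF X] by blast
  then have "elts (pair k (pair m n)) = Collect X" using k by (auto simp: elts_pair)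
  then have "?C (pair k (pair m n))" unfolding C triple_def by blast
  moreover have "delta1 (\<lambda>e. ?C (e 0))"
    by (intro delta1_intros delta1_triple delta1_elts delta1_rel1[OF X])
  ultimately obtain c where "?C c" "\<forall>d. d \<prec> c \<longrightarrow> \<not> ?C d"
    using delta1_least[of ?C] by blast
  then have "set_code c \<and> elts c = Collect X"
    unfolding C set_code_iff by (metis ar.not_le)
  then show ?thesis by blast
qed

end

section \<open>Sequences and partial sums\<close>

context rca0
begin

lemma fin_seq_entry:
  assumes "fin_seq s l"
  shows "pair i j \<in> elts s \<longleftrightarrow> i \<prec> l \<and> entry s i = j"
proof -
  have *: "pair i j \<in> elts s \<Longrightarrow> pair i k \<in> elts s \<Longrightarrow> j = k" "i \<prec> l \<longleftrightarrow> (\<exists>j. pair i j \<in> elts s)"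
    for i j k using assms unfolding fin_seq_def by blast+
  have "entry s i = j" if "pair i j \<in> elts s" for j
  proof -
    have "(THE j. pair i j \<in> elts s) = j" by (rule the_equality) (use that *(1) in blast)+
    moreover have "\<exists>j. pair i j \<in> elts s" using that by blast
    ultimately show ?thesis by (simp add: entry_def)
  qed
  then show ?thesis using *(2) by metis
qed

lemma fin_seq_entry_outside: "fin_seq s l \<Longrightarrow> \<not> i \<prec> l \<Longrightarrow> entry s i = \<zero>"
  unfolding entry_def using fin_seq_entry by simp

lemma fin_seq_pair: "fin_seq s l \<Longrightarrow> n \<in> elts s \<Longrightarrow> \<exists>i j. n = pair i j"
  unfolding fin_seq_def by meson

lemma fin_seq_eqI:
  assumes s: "fin_seq s l" and t: "fin_seq t l" and eq: "\<And>i. i \<prec> l \<Longrightarrow> entry s i = entry t i"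
  shows "s = t"
proof (rule set_code_unique)
  show "set_code s" "set_code t" using s t by (simp_all add: fin_seq_def)
  have "n \<in> elts s \<longleftrightarrow> n \<in> elts t" for n
  proof (cases "\<exists>i j. n = pair i j")
    case True
    then show ?thesis using fin_seq_entry[OF s] fin_seq_entry[OF t] eq by auto
  next
    case False
    then show ?thesis using fin_seq_pair[OF s] fin_seq_pair[OF t] by blast
  qed
  then show "elts s = elts t" by blast
qed

lemma below_inject: "(\<And>i. i \<prec> k \<longleftrightarrow> i \<prec> l) \<Longrightarrow> k = l"
  using linear less_irrefl by metis

lemma fin_seq_length_unique: "fin_seq s k \<Longrightarrow> fin_seq s l \<Longrightarrow> k = l"
  by (rule below_inject) (auto simp: fin_seq_def)

lemma fin_seq_length_leq: "fin_seq s l \<Longrightarrow> l \<preceq> s"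
  using fin_seq_entry pair_elts_less(1) ar.not_le less_irrefl by metis

lemma fin_seq_entry_leq: "fin_seq s l \<Longrightarrow> entry s i \<preceq> s"
  by (metis fin_seq_entry fin_seq_entry_outside pair_elts_less(2) ar.less_imp_le zero_leq)

lemma fin_seq_bounded: "fin_seq s l \<longleftrightarrow> set_code s \<and>
    (\<forall>n. n \<prec> s \<longrightarrow> n \<in> elts s \<longrightarrow> (\<exists>i. i \<prec> s \<and> (\<exists>j. j \<prec> s \<and> n = pair i j))) \<and>
    (\<forall>i. i \<prec> s \<longrightarrow> (\<forall>j. j \<prec> s \<longrightarrow> (\<forall>k. k \<prec> s \<longrightarrow>
      pair i j \<in> elts s \<and> pair i k \<in> elts s \<longrightarrow> j = k))) \<and>
    (\<forall>i. i \<prec> l \<longrightarrow> (\<exists>j. j \<prec> s \<and> pair i j \<in> elts s)) \<and>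
    (\<forall>i. i \<prec> s \<longrightarrow> (\<forall>j. j \<prec> s \<longrightarrow> pair i j \<in> elts s \<longrightarrow> i \<prec> l))"
proof -
  have "(\<exists>i j. n = pair i j) \<longleftrightarrow> (\<exists>i. i \<prec> s \<and> (\<exists>j. j \<prec> s \<and> n = pair i j))"
    if "n \<in> elts s" for n
    using that pair_elts_less[of _ _ s] by auto
  then have "(\<forall>n\<in>elts s. \<exists>i j. n = pair i j) \<longleftrightarrow>
      (\<forall>n. n \<prec> s \<longrightarrow> n \<in> elts s \<longrightarrow> (\<exists>i. i \<prec> s \<and> (\<exists>j. j \<prec> s \<and> n = pair i j)))"
    using elts_less by meson
  moreover have "(\<forall>i j k. pair i j \<in> elts s \<and> pair i k \<in> elts s \<longrightarrow> j = k) \<longleftrightarrow>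
      (\<forall>i. i \<prec> s \<longrightarrow> (\<forall>j. j \<prec> s \<longrightarrow> (\<forall>k. k \<prec> s \<longrightarrow>
        pair i j \<in> elts s \<and> pair i k \<in> elts s \<longrightarrow> j = k)))"
    using pair_elts_less[of _ _ s] by blast
  moreover have "(\<forall>i. i \<prec> l \<longleftrightarrow> (\<exists>j. pair i j \<in> elts s)) \<longleftrightarrow>
      (\<forall>i. i \<prec> l \<longrightarrow> (\<exists>j. j \<prec> s \<and> pair i j \<in> elts s)) \<and>
      (\<forall>i. i \<prec> s \<longrightarrow> (\<forall>j. j \<prec> s \<longrightarrow> pair i j \<in> elts s \<longrightarrow> i \<prec> l))"
    using pair_elts_less[of _ _ s] by blast
  ultimately show ?thesis unfolding fin_seq_def by argo
qed

lemma delta1_fin_seq: "recfn f \<Longrightarrow> recfn g \<Longrightarrow> delta1 (\<lambda>e. fin_seq (f e) (g e))"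
  by (erule (1) delta1_rel2[where R = fin_seq, rotated])
    (unfold fin_seq_bounded, intro delta1_intros delta1_set_code delta1_elts recfn_pair)

lemma recfn_bounded:
  assumes f: "recfn (\<lambda>e. f (e 0))"
  shows "\<exists>b. \<forall>i. i \<prec> l \<longrightarrow> f i \<prec> b"
proof (induct l rule: sigma1_induct)
  case (step l)
  then obtain b where b: "\<And>i. i \<prec> l \<Longrightarrow> f i \<prec> b" by blast
  obtain b' where "b \<prec> b'" "f l \<prec> b'" using bound2 by blast
  with b show ?case unfolding less_add_one using ar.less_trans by blast
next
  case sigma1
  show ?case by (intro sigma1_ex sigma1_delta1 delta1_intros recfn_fun1[OF f])
qed (simp add: not_less_zero)

text \<open>The graph of \<open>f\<close> below \<open>l\<close> is a
  \<open>\<Delta>\<^sup>0\<^sub>1\<close> class, and \<open>recfn_bounded\<close> makes it bounded,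
  so it has a code.\<close>

lemma fin_seq_exists:
  assumes f: "recfn (\<lambda>e. f (e 0))"
  shows "\<exists>s. fin_seq s l \<and> (\<forall>i. i \<prec> l \<longrightarrow> entry s i = f i)"
proof -
  let ?X = "\<lambda>n. \<exists>i. i \<prec> l \<and> n = pair i (f i)"
  have "recfn (\<lambda>e. pair (e 0) (f (e 0)))" by (intro recfn_pair recfn_var f)
  from recfn_bounded[OF this] obtain k where k: "\<forall>i. i \<prec> l \<longrightarrow> pair i (f i) \<prec> k" by blast
  have "delta1 (\<lambda>e. ?X (e 0))" by (intro delta1_intros recfn_pair recfn_fun1[OF f])
  from set_code_exists[OF this, of k] k obtain s where s: "set_code s" "elts s = Collect ?X"
    by blast
  then have seq: "fin_seq s l" unfolding fin_seq_def by auto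
  moreover have "entry s i = f i" if "i \<prec> l" for i
    using fin_seq_entry[OF seq, of i "f i"] that s(2) by blast
  ultimately show ?thesis by blast
qed

text \<open>
  For \<open>s\<close> not the code of a sequence, the description in \<open>entry s\<close> may be improper; \<open>ent\<close> is a
  recursive function agreeing with \<open>entry\<close> on codes of sequences.
\<close>

definition ent :: "'m \<Rightarrow> 'm \<Rightarrow> 'm" where
  "ent s i = (THE j. pair i j \<in> elts s \<and> (\<forall>k. k \<prec> j \<longrightarrow> pair i k \<notin> elts s) \<or>
     j = \<zero> \<and> (\<forall>k. k \<prec> s \<longrightarrow> pair i k \<notin> elts s))"

lemma ent_eq_iff: "j = ent s i \<longleftrightarrow> pair i j \<in> elts s \<and> (\<forall>k. k \<prec> j \<longrightarrow> pair i k \<notin> elts s) \<or>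
     j = \<zero> \<and> (\<forall>k. k \<prec> s \<longrightarrow> pair i k \<notin> elts s)" (is "_ \<longleftrightarrow> ?G j")
proof -
  have "\<exists>!j. ?G j"
  proof (rule ex_ex1I)
    show "\<exists>j. ?G j"
    proof (cases "\<exists>j. pair i j \<in> elts s")
      case True
      then obtain j where j: "pair i j \<in> elts s" by blast
      have "delta1 (\<lambda>e. pair i (e 0) \<in> elts s)" by (intro delta1_elts recfn_pair delta1_intros)
      from delta1_least[OF this, of j] j show ?thesis by blast
    qed blast
    show "?G j \<Longrightarrow> ?G k \<Longrightarrow> j = k" for j k
      using pair_elts_less(2) linear by metis
  qed
  then have "?G (ent s i)" unfolding ent_def by (rule theI')
  with \<open>\<exists>!j. ?G j\<close> show ?thesis by blast
qed

lemma recfn_ent: "recfn f \<Longrightarrow> recfn g \<Longrightarrow> recfn (\<lambda>e. ent (f e) (g e))"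
  by (erule (1) recfn_fun2[where F = ent, rotated])
    (unfold recfn_def ent_eq_iff, intro sigma1_delta1 delta1_intros delta1_elts recfn_pair)

lemma ent_eq_entry:
  assumes "fin_seq s l" shows "ent s i = entry s i"
proof -
  have "entry s i = ent s i"
    unfolding ent_eq_iff fin_seq_entry[OF assms]
    using fin_seq_entry_outside[OF assms] less_irrefl by blast
  then show ?thesis by simp
qed

section \<open>Partial sums as a recursive function\<close>

definition is_sums :: "'m \<Rightarrow> 'm \<Rightarrow> 'm \<Rightarrow> bool" where
  "is_sums D s l \<longleftrightarrow> fin_seq s (l \<oplus> \<one>) \<and> ent s \<zero> = \<zero> \<and>
     (\<forall>i. i \<prec> l \<longrightarrow> ent s (i \<oplus> \<one>) = ent s i \<oplus> ent D i)"

text \<open>Reading entries with \<open>ent\<close> and leaving \<open>l\<close> free makes this a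
  total recursive function of two arguments, which may occur in induction statements. For sequences
  it yields \<open>size\<close> (\<open>size_eq_psum\<close>).\<close>

definition psum :: "'m \<Rightarrow> 'm \<Rightarrow> 'm" where
  "psum D l = (THE n. \<exists>s. is_sums D s l \<and> n = ent s l)"

lemma delta1_is_sums:
  assumes "recfn f" "recfn g" "recfn h"
  shows "delta1 (\<lambda>e. is_sums (f e) (g e) (h e))"
  unfolding is_sums_def
  by (intro delta1_intros delta1_fin_seq recfn_ent assms[THEN recfn_shift] assms)

lemma is_sums_step:
  assumes s: "is_sums D s l"
  shows "\<exists>t. is_sums D t (l \<oplus> \<one>) \<and> ent t l = ent s l"
proof -
  let ?f = "\<lambda>i. if i \<prec> l \<oplus> \<one> then ent s i else ent s l \<oplus> ent D l"
  have "recfn (\<lambda>e. ?f (e 0))" by (intro recfn_if recfn_ent delta1_intros)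
  from fin_seq_exists[OF this] obtain t where
    t: "fin_seq t (l \<oplus> \<one> \<oplus> \<one>)" "\<And>i. i \<prec> l \<oplus> \<one> \<oplus> \<one> \<Longrightarrow> entry t i = ?f i" by blast
  have e: "ent t i = ?f i" if "i \<prec> l \<oplus> \<one> \<oplus> \<one>" for i
    using t that by (simp only: ent_eq_entry[OF t(1)])
  have *: "ent t i = ent s i" if "i \<preceq> l" for i
    using e[of i] that less_add_one_iff less_add_one by auto
  have "ent t (i \<oplus> \<one>) = ent t i \<oplus> ent D i" if "i \<prec> l \<oplus> \<one>" for i
  proof (cases "i \<prec> l")
    case True
    then have "i \<oplus> \<one> \<preceq> l" "i \<preceq> l" by (simp_all only: add_one_leq_iff ar.less_imp_le)
    then show ?thesis using s True * unfolding is_sums_def by simp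
  next
    case False
    then have "i = l" using that unfolding less_add_one by blast
    then show ?thesis using e[of "l \<oplus> \<one>"] *[of l] less_irrefl[of "l \<oplus> \<one>"]
      by (simp add: less_add_one leq_def)
  qed
  moreover have "ent t \<zero> = \<zero>" using s * unfolding is_sums_def by simp
  ultimately have "is_sums D t (l \<oplus> \<one>)" using t(1) unfolding is_sums_def by blast
  moreover have "ent t l = ent s l" using * by simp
  ultimately show ?thesis by blast
qed

lemma is_sums_exists: "\<exists>s. is_sums D s l"
proof (induct l rule: sigma1_induct)
  case zero
  have "recfn (\<lambda>e. \<zero>)" by (rule recfn_const)
  from fin_seq_exists[OF this, of "\<zero> \<oplus> \<one>"] obtain s where
    s: "fin_seq s (\<zero> \<oplus> \<one>)" "\<And>i. i \<prec> \<zero> \<oplus> \<one> \<Longrightarrow> entry s i = \<zero>" by blast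
  have "is_sums D s \<zero>" unfolding is_sums_def ent_eq_entry[OF s(1)]
    using s zero_less_add_one not_less_zero by blast
  then show ?case by blast
next
  case (step l) then show ?case using is_sums_step by blast
next
  case sigma1 show ?case by (intro sigma1_ex sigma1_delta1 delta1_is_sums delta1_intros)
qed

lemma is_sums_unique:
  assumes "is_sums D s l" "is_sums D t k"
  shows "i \<preceq> l \<longrightarrow> i \<preceq> k \<longrightarrow> ent s i = ent t i"
proof (induct i rule: delta1_induct)
  case zero show ?case using assms by (simp add: is_sums_def)
next
  case (step i)
  show ?case
  proof (intro impI)
    assume "i \<oplus> \<one> \<preceq> l" "i \<oplus> \<one> \<preceq> k"
    then have "i \<prec> l" "i \<prec> k" by (simp_all add: add_one_leq_iff)
    then show "ent s (i \<oplus> \<one>) = ent t (i \<oplus> \<one>)" using step assms by (simp add: is_sums_def leq_def)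
  qed
next
  case delta1 show ?case by (intro delta1_intros recfn_ent)
qed

lemma psum_eq_iff: "n = psum D l \<longleftrightarrow> (\<exists>s. is_sums D s l \<and> n = ent s l)"
proof -
  obtain s where s: "is_sums D s l" using is_sums_exists by blast
  have *: "ent t l = ent s l" if "is_sums D t l" for t
    using is_sums_unique[OF that s, of l] by simp
  have "psum D l = ent s l" unfolding psum_def
    by (rule the_equality) (use s * in blast)+
  then show ?thesis using s * by metis
qed

lemma recfn_psum: "recfn f \<Longrightarrow> recfn g \<Longrightarrow> recfn (\<lambda>e. psum (f e) (g e))"
  by (erule (1) recfn_fun2[where F = psum, rotated])
    (unfold recfn_def psum_eq_iff, intro sigma1_ex sigma1_delta1 delta1_intros delta1_is_sums recfn_ent)

lemma psum_zero: "psum D \<zero> = \<zero>"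
  by (rule sym) (use is_sums_exists[of D \<zero>] in \<open>auto simp: psum_eq_iff is_sums_def\<close>)

lemma psum_step: "psum D (l \<oplus> \<one>) = psum D l \<oplus> ent D l"
proof -
  obtain s where s: "is_sums D s l" using is_sums_exists by blast
  obtain t where t: "is_sums D t (l \<oplus> \<one>)" "ent t l = ent s l" using is_sums_step[OF s] by blast
  have "psum D l = ent s l" "psum D (l \<oplus> \<one>) = ent t (l \<oplus> \<one>)"
    using s t(1) psum_eq_iff by metis+
  moreover have "ent t (l \<oplus> \<one>) = ent t l \<oplus> ent D l"
    using t(1) unfolding is_sums_def less_add_one by blast
  ultimately show ?thesis using t(2) by simp
qed

lemma psum_mono:
  assumes "\<And>i. ent D i \<preceq> ent E i" shows "psum D l \<preceq> psum E l"
proof (induct l rule: delta1_induct)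
  case (step l) then show ?case using assms by (simp add: psum_step ar.add_mono)
next
  case delta1 show ?case by (intro delta1_intros recfn_psum)
qed (simp add: psum_zero)

lemma psum_strict_mono:
  assumes "\<And>i. ent D i \<preceq> ent E i" "ent D k \<prec> ent E k"
  shows "k \<prec> l \<longrightarrow> psum D l \<prec> psum E l"
proof (induct l rule: delta1_induct)
  case zero show ?case by (simp add: not_less_zero)
next
  case (step l)
  show ?case
  proof
    assume "k \<prec> l \<oplus> \<one>"
    then consider "k \<prec> l" | "k = l" unfolding less_add_one by blast
    then show "psum D (l \<oplus> \<one>) \<prec> psum E (l \<oplus> \<one>)"
    proof cases
      case 1
      then show ?thesis unfolding psum_step using step assms(1) by (intro ar.add_less_le_mono) auto
    next
      case 2
      then show ?thesis unfolding psum_step using psum_mono assms by (intro ar.add_le_less_mono) auto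
    qed
  qed
next
  case delta1 show ?case by (intro delta1_intros recfn_psum)
qed

lemma psum_leq:
  assumes "\<And>i. ent D i \<preceq> r" shows "psum D l \<preceq> r \<otimes> l"
proof (induct l rule: delta1_induct)
  case (step l) then show ?case using assms by (simp add: psum_step mult_add_one ar.add_mono)
next
  case delta1 show ?case by (intro delta1_intros recfn_psum)
qed (simp add: psum_zero)

lemma psum_eventually:
  assumes "\<And>i. \<not> i \<prec> k \<Longrightarrow> ent D i = \<zero>"
  shows "k \<preceq> l \<longrightarrow> psum D l = psum D k"
proof (induct l rule: delta1_induct)
  case zero
  show ?case using ar.order_antisym[OF zero_leq] by (metis psum_zero)
next
  case (step l)
  show ?case
  proof
    assume "k \<preceq> l \<oplus> \<one>"
    then consider "k \<preceq> l" | "k = l \<oplus> \<one>" unfolding leq_def less_add_one by blast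
    then show "psum D (l \<oplus> \<one>) = psum D k"
    proof cases
      case 1
      then show ?thesis using step assms[of l] by (simp add: psum_step ar.not_less)
    qed simp
  qed
next
  case delta1 show ?case by (intro delta1_intros recfn_psum)
qed

end

section \<open>Diagrams\<close>

context rca0
begin

lemma maximum_leq_iff: "maximum a b \<preceq> c \<longleftrightarrow> a \<preceq> c \<and> b \<preceq> c"
  unfolding maximum_def using ar.less_imp_le ar.not_le ar.order_trans by (metis (full_types))

lemma leq_maximum1: "a \<preceq> maximum a b" and leq_maximum2: "b \<preceq> maximum a b"
  using maximum_leq_iff[of a b "maximum a b"] by simp_all

lemma less_maximum_iff: "a \<prec> maximum b c \<longleftrightarrow> a \<prec> b \<or> a \<prec> c"
  using maximum_leq_iff[of b c a] by (metis ar.not_le)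

lemma zero_less_iff: "\<zero> \<prec> a \<longleftrightarrow> a \<noteq> \<zero>"
  using zero_leq[of a] less_irrefl by (auto simp: leq_def)

lemma one_leq_iff: "\<one> \<preceq> a \<longleftrightarrow> \<zero> \<prec> a"
  using add_one_leq_iff[of \<zero> a] by (simp add: zero_add)

lemma leq_zero_iff: "a \<preceq> \<zero> \<longleftrightarrow> a = \<zero>"
  by (auto simp: leq_def not_less_zero)

lemma less_one_iff: "a \<prec> \<one> \<longleftrightarrow> a = \<zero>"
  using less_add_one_iff[of a \<zero>] by (simp add: zero_add leq_zero_iff)

lemma diagramE:
  assumes "diagram D"
  obtains k where "fin_seq D k" "\<zero> \<prec> k" "\<And>i. \<zero> \<prec> row D i \<longleftrightarrow> i \<prec> k" "k \<preceq> D"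
proof -
  obtain k where k: "fin_seq D k" "\<zero> \<prec> k" "\<forall>i. i \<prec> k \<longrightarrow> \<zero> \<prec> row D i"
    using assms unfolding diagram_def by blast
  have "\<zero> \<prec> row D i \<longleftrightarrow> i \<prec> k" for i
    using k(3) fin_seq_entry_outside[OF k(1), of i] less_irrefl by metis
  with that k fin_seq_length_leq[OF k(1)] show thesis by blast
qed

lemma diagram_row_antimono:
  assumes "diagram D" "i \<preceq> j" shows "row D j \<preceq> row D i"
proof -
  obtain k where k: "fin_seq D k" "\<forall>i j. i \<prec> j \<and> j \<prec> k \<longrightarrow> row D j \<preceq> row D i"
    using assms(1) unfolding diagram_def by blast
  show ?thesis
  proof (cases "j \<prec> k")
    case True
    then show ?thesis using assms(2) k(2) unfolding leq_def by blast
  next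
    case False
    then show ?thesis using fin_seq_entry_outside[OF k(1)] by simp
  qed
qed

lemma diagram_row_zero: "diagram D \<Longrightarrow> \<zero> \<prec> row D \<zero>"
  by (erule diagramE) simp

lemma diagram_row_leq: "diagram D \<Longrightarrow> row D i \<preceq> D"
  by (erule diagramE) (rule fin_seq_entry_leq)

text \<open>The code of a diagram is at least its number of rows, so \<open>D\<close> itself can be
  used as an index from which on all rows are empty.\<close>

lemma diagram_row_outside: "diagram D \<Longrightarrow> D \<preceq> i \<Longrightarrow> row D i = \<zero>"
  by (erule diagramE) (metis ar.less_le_trans ar.order_trans less_irrefl zero_less_iff)

lemma diagram_ent: "diagram D \<Longrightarrow> ent D i = row D i"
  by (erule diagramE) (rule ent_eq_entry)

lemma diagram_eqI:
  assumes D: "diagram D" and E: "diagram E" and eq: "\<And>i. row D i = row E i"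
  shows "D = E"
proof -
  obtain k where k: "fin_seq D k" "\<And>i. \<zero> \<prec> row D i \<longleftrightarrow> i \<prec> k" by (rule diagramE[OF D]) blast
  obtain l where l: "fin_seq E l" "\<And>i. \<zero> \<prec> row E i \<longleftrightarrow> i \<prec> l" by (rule diagramE[OF E]) blast
  have "k = l" by (rule below_inject) (simp add: eq flip: k(2) l(2))
  then show ?thesis using fin_seq_eqI k(1) l(1) eq by blast
qed

text \<open>Rows within the length of a diagram must be positive, which forces the length to be the
  least zero of \<open>f\<close>. The zero at \<open>l\<close> guarantees that there is one.\<close>

lemma diagram_exists:
  assumes f: "recfn (\<lambda>e. f (e 0))" and anti: "\<And>i j. i \<preceq> j \<Longrightarrow> f j \<preceq> f i"
    and "\<zero> \<prec> f \<zero>" "f l = \<zero>"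
  shows "\<exists>D. diagram D \<and> (\<forall>i. row D i = f i)"
proof -
  have "delta1 (\<lambda>e. f (e 0) = \<zero>)" by (intro delta1_intros f)
  from delta1_least[OF this, of l] obtain k where k: "f k = \<zero>" "\<And>i. i \<prec> k \<Longrightarrow> f i \<noteq> \<zero>"
    using assms(4) by blast
  obtain D where D: "fin_seq D k" "\<And>i. i \<prec> k \<Longrightarrow> row D i = f i" using fin_seq_exists[OF f] by blast
  have row: "row D i = f i" for i
  proof (cases "i \<prec> k")
    case False
    then have "f i \<preceq> f k" using anti ar.not_less by blast
    then show ?thesis using False fin_seq_entry_outside[OF D(1)] by (simp add: k(1) leq_zero_iff)
  qed (rule D(2))
  have "k \<noteq> \<zero>" using k(1) assms(3) less_irrefl by auto
  moreover have "f j \<preceq> f i" if "i \<prec> j" for i j using anti that ar.less_imp_le by blast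
  ultimately have "diagram D" unfolding diagram_def row using D(1) k(2) zero_less_iff by blast
  then show ?thesis using row by blast
qed

lemma delta1_diagram:
  assumes "recfn f" shows "delta1 (\<lambda>e. diagram (f e))"
proof -
  have "diagram D \<longleftrightarrow> (\<exists>k. k \<prec> D \<oplus> \<one> \<and> fin_seq D k \<and> \<zero> \<prec> k \<and> (\<forall>i. i \<prec> k \<longrightarrow> \<zero> \<prec> ent D i) \<and>
      (\<forall>j. j \<prec> k \<longrightarrow> (\<forall>i. i \<prec> j \<longrightarrow> ent D j \<preceq> ent D i)))" for D
    unfolding diagram_def less_add_one_iff using ent_eq_entry fin_seq_length_leq by metis
  then have "delta1 (\<lambda>e. diagram (e 0))"
    by (simp only:) (intro delta1_intros delta1_fin_seq recfn_ent)
  then show ?thesis using assms by (rule delta1_rel1)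
qed

lemma recfn_row: "diagram D \<Longrightarrow> recfn f \<Longrightarrow> recfn (\<lambda>e. row D (f e))"
  using recfn_ent[OF recfn_const, of f D] by (simp only: diagram_ent)

lemma col_eqI: "(\<And>i. i \<prec> c \<longleftrightarrow> j \<prec> row D i) \<Longrightarrow> col D j = c"
  unfolding col_def by (rule the_equality) (simp, rule below_inject, simp)

text \<open>The column length is the least index whose row has at most \<open>j\<close> boxes; it
  exists since rows vanish eventually. From here on columns are handled through this symmetry
  between rows and columns.\<close>

lemma less_col_iff:
  assumes D: "diagram D" shows "i \<prec> col D j \<longleftrightarrow> j \<prec> row D i"
proof -
  have "delta1 (\<lambda>e. row D (e 0) \<preceq> j)" by (intro delta1_intros recfn_row D)
  from delta1_least[OF this, of D] obtain c where
    c: "row D c \<preceq> j" "\<And>i. i \<prec> c \<Longrightarrow> \<not> row D i \<preceq> j"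
    using diagram_row_outside[OF D, of D] by auto
  have c: "i \<prec> c \<longleftrightarrow> j \<prec> row D i" for i
    using c diagram_row_antimono[OF D, of c i] by (metis ar.not_le ar.order_trans)
  then have "col D j = c" by (rule col_eqI)
  with c show ?thesis by simp
qed

lemma col_zero:
  assumes D: "diagram D" shows "fin_seq D (col D \<zero>)" "col D \<zero> \<preceq> D" "\<zero> \<prec> col D \<zero>"
proof -
  obtain k where k: "fin_seq D k" "\<zero> \<prec> k" "\<And>i. \<zero> \<prec> row D i \<longleftrightarrow> i \<prec> k" "k \<preceq> D" by (rule diagramE[OF D]) blast
  have "col D \<zero> = k" by (rule col_eqI) (simp add: k(3))
  with k show "fin_seq D (col D \<zero>)" "col D \<zero> \<preceq> D" "\<zero> \<prec> col D \<zero>" by simp_all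
qed

section \<open>Unions, reductions and the order of diagrams in terms of rows\<close>

lemma dunion_rows:
  assumes D: "diagram D" and E: "diagram E"
  shows "diagram (dunion D E)" "row (dunion D E) i = maximum (row D i) (row E i)"
proof -
  let ?f = "\<lambda>i. maximum (row D i) (row E i)"
  have "\<exists>F. diagram F \<and> (\<forall>i. row F i = ?f i)"
  proof (rule diagram_exists[where l = "maximum D E"])
    show "recfn (\<lambda>e. ?f (e 0))" by (intro recfn_maximum recfn_row D E recfn_var)
    show "?f j \<preceq> ?f i" if "i \<preceq> j" for i j
      using diagram_row_antimono[OF D that] diagram_row_antimono[OF E that]
        leq_maximum1 leq_maximum2 ar.order_trans unfolding maximum_leq_iff by blast
    show "\<zero> \<prec> ?f \<zero>" using diagram_row_zero[OF D] by (simp add: less_maximum_iff)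
    show "?f (maximum D E) = \<zero>"
      using diagram_row_outside[OF D leq_maximum1] diagram_row_outside[OF E leq_maximum2]
      by (simp add: maximum_def)
  qed
  then obtain F where F: "diagram F" "\<forall>i. row F i = ?f i" by blast
  have "dunion D E = F" unfolding dunion_def
    by (rule the_equality) (use F in \<open>auto intro: diagram_eqI\<close>)
  with F show "diagram (dunion D E)" "row (dunion D E) i = ?f i" by simp_all
qed

lemma reduce_r_rows:
  assumes D: "diagram D"
  shows "diagram (reduce_r D)"
    "row (reduce_r D) i = (if i = \<zero> then maximum (row D \<one>) \<one> else row D i)"
proof -
  let ?f = "\<lambda>i. if i = \<zero> then maximum (row D \<one>) \<one> else row D i"
  have "\<exists>F. diagram F \<and> (\<forall>i. row F i = ?f i)"
  proof (rule diagram_exists[where l = "D \<oplus> \<one>"])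
    show "recfn (\<lambda>e. ?f (e 0))" by (intro recfn_if recfn_maximum recfn_row D delta1_intros)
    fix i j assume ij: "i \<preceq> j"
    show "?f j \<preceq> ?f i"
    proof (cases "i = \<zero> \<and> j \<noteq> \<zero>")
      case True
      then have "row D j \<preceq> row D \<one>" by (intro diagram_row_antimono D) (simp add: one_leq_iff zero_less_iff)
      then show ?thesis using True leq_maximum1 ar.order_trans by auto
    next
      case False
      then show ?thesis using diagram_row_antimono[OF D ij] ij by (auto simp: leq_zero_iff)
    qed
  next
    show "\<zero> \<prec> ?f \<zero>" by (simp add: less_maximum_iff)
    show "?f (D \<oplus> \<one>) = \<zero>" using diagram_row_outside[OF D, of "D \<oplus> \<one>"] add_one_neq_zero by simp
  qed
  then obtain F where F: "diagram F" "\<And>i. row F i = ?f i" by blast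
  have "reduce_r D = F" unfolding reduce_r_def
  proof (rule the_equality)
    fix G assume G: "diagram G \<and> row G \<zero> = maximum (row D \<one>) \<one> \<and> (\<forall>i. \<zero> \<prec> i \<longrightarrow> row G i = row D i)"
    show "G = F"
    proof (rule diagram_eqI)
      show "row G i = row F i" for i using G unfolding F(2) zero_less_iff by (cases "i = \<zero>") simp_all
    qed (use G F in blast)+
  next
    show "diagram F \<and> row F \<zero> = maximum (row D \<one>) \<one> \<and> (\<forall>i. \<zero> \<prec> i \<longrightarrow> row F i = row D i)"
      using F(1) unfolding F(2) zero_less_iff by simp
  qed
  with F show "diagram (reduce_r D)" "row (reduce_r D) i = ?f i" by simp_all
qed

lemma diagram_eq_if_cols_eq:
  assumes D: "diagram D" and E: "diagram E" and eq: "\<And>j. col D j = col E j"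
  shows "D = E"
proof (rule diagram_eqI[OF D E])
  show "row D i = row E i" for i
    by (rule below_inject) (simp add: eq flip: less_col_iff[OF D] less_col_iff[OF E])
qed

text \<open>Cutting the first column down to the second, but not below one box, deletes exactly the
  rows of length one other than the first. In this row form \<open>diagram_exists\<close> applies
  directly.\<close>

lemma reduce_c_rows:
  assumes D: "diagram D"
  shows "diagram (reduce_c D)"
    "row (reduce_c D) i = (if i = \<zero> \<or> \<one> \<prec> row D i then row D i else \<zero>)"
proof -
  let ?f = "\<lambda>i. if i = \<zero> \<or> \<one> \<prec> row D i then row D i else \<zero>"
  have "\<exists>F. diagram F \<and> (\<forall>i. row F i = ?f i)"
  proof (rule diagram_exists[where l = "D \<oplus> \<one>"])
    show "recfn (\<lambda>e. ?f (e 0))" by (intro recfn_if recfn_row D delta1_intros)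
    fix i j assume ij: "i \<preceq> j"
    show "?f j \<preceq> ?f i"
      using diagram_row_antimono[OF D ij] ij ar.less_le_trans by (auto simp: leq_zero_iff)
  next
    show "\<zero> \<prec> ?f \<zero>" using diagram_row_zero[OF D] by simp
    show "?f (D \<oplus> \<one>) = \<zero>" using diagram_row_outside[OF D, of "D \<oplus> \<one>"] add_one_neq_zero by simp
  qed
  then obtain F where F: "diagram F" "\<And>i. row F i = ?f i" by blast
  have F0: "col F \<zero> = maximum (col D \<one>) \<one>"
  proof (rule col_eqI)
    show "i \<prec> maximum (col D \<one>) \<one> \<longleftrightarrow> \<zero> \<prec> row F i" for i
      using diagram_row_zero[OF D] ar.less_trans[OF ar.zero_less_one, of "row D i"] less_irrefl
      by (auto simp: less_maximum_iff less_col_iff[OF D] F(2) less_one_iff)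
  qed
  have Fj: "col F j = col D j" if "\<zero> \<prec> j" for j
  proof (rule col_eqI)
    have "\<one> \<preceq> j" using that by (simp add: one_leq_iff)
    then show "i \<prec> col D j \<longleftrightarrow> j \<prec> row F i" for i
      using ar.le_less_trans not_less_zero by (auto simp: less_col_iff[OF D] F(2))
  qed
  have "reduce_c D = F" unfolding reduce_c_def
  proof (rule the_equality)
    fix G assume G: "diagram G \<and> col G \<zero> = maximum (col D \<one>) \<one> \<and> (\<forall>j. \<zero> \<prec> j \<longrightarrow> col G j = col D j)"
    show "G = F"
    proof (rule diagram_eq_if_cols_eq)
      show "col G j = col F j" for j using G F0 Fj unfolding zero_less_iff by metis
    qed (use G F in blast)+
  qed (use F F0 Fj in blast)
  with F show "diagram (reduce_c D)" "row (reduce_c D) i = ?f i" by simp_all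
qed

lemma dle_refl: "dle D D"
  by (simp add: dle_def)

lemma dle_trans: "dle D E \<Longrightarrow> dle E F \<Longrightarrow> dle D F"
  unfolding dle_def using ar.order_trans by blast

lemma dle_dunion_iff:
  "diagram D \<Longrightarrow> diagram E \<Longrightarrow> dle (dunion D E) F \<longleftrightarrow> dle D F \<and> dle E F"
  unfolding dle_def dunion_rows(2) maximum_leq_iff by blast

text \<open>The first row of \<open>reduce_r D\<close> puts no further condition on
  \<open>F\<close>: the first row of \<open>F\<close> is nonempty and at least as long as its
  second.\<close>

lemma dle_reduce_r_iff:
  assumes D: "diagram D" and F: "diagram F"
  shows "dle (reduce_r D) F \<longleftrightarrow> (\<forall>i. \<zero> \<prec> i \<longrightarrow> row D i \<preceq> row F i)"
proof
  assume "dle (reduce_r D) F"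
  then show "\<forall>i. \<zero> \<prec> i \<longrightarrow> row D i \<preceq> row F i"
    unfolding dle_def reduce_r_rows(2)[OF D] zero_less_iff by presburger
next
  assume *: "\<forall>i. \<zero> \<prec> i \<longrightarrow> row D i \<preceq> row F i"
  have "row F \<one> \<preceq> row F \<zero>" by (intro diagram_row_antimono[OF F]) simp
  moreover have "row D \<one> \<preceq> row F \<one>" using * by simp
  moreover have "\<one> \<preceq> row F \<zero>" using diagram_row_zero[OF F] by (simp add: one_leq_iff)
  ultimately have "maximum (row D \<one>) \<one> \<preceq> row F \<zero>"
    unfolding maximum_leq_iff using ar.order_trans by blast
  with * show "dle (reduce_r D) F"
    unfolding dle_def reduce_r_rows(2)[OF D] zero_less_iff by simp
qed

lemma dle_reduce_c_iff:
  assumes D: "diagram D"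
  shows "dle (reduce_c D) F \<longleftrightarrow> (\<forall>i. i = \<zero> \<or> \<one> \<prec> row D i \<longrightarrow> row D i \<preceq> row F i)"
  unfolding dle_def reduce_c_rows(2)[OF D] by simp

lemma dle_if_reduce_r:
  assumes "diagram D" "diagram F" "dle (reduce_r D) F" "row D \<zero> \<preceq> row F \<zero>"
  shows "dle D F"
  using assms(3,4) unfolding dle_reduce_r_iff[OF assms(1,2)]
  unfolding dle_def zero_less_iff by metis

text \<open>The last assumption compares the first columns of \<open>D\<close> and \<open>F\<close>;
  it is what takes care of the rows of length one that \<open>reduce_c\<close> may have
  deleted.\<close>

lemma dle_if_reduce_c:
  assumes D: "diagram D" and F: "dle (reduce_c D) F" "\<And>i. \<zero> \<prec> row D i \<Longrightarrow> \<zero> \<prec> row F i"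
  shows "dle D F"
  unfolding dle_def
proof
  fix i
  consider "\<one> \<prec> row D i" | "row D i = \<zero>" | "row D i \<preceq> \<one>" "\<zero> \<prec> row D i"
    using ar.not_less zero_less_iff by metis
  then show "row D i \<preceq> row F i"
  proof cases
    case 1 then show ?thesis using F(1) unfolding dle_reduce_c_iff[OF D] by blast
  next
    case 2 then show ?thesis by simp
  next
    case 3
    then have "\<one> \<preceq> row F i" using F(2) by (simp add: one_leq_iff)
    then show ?thesis using 3(1) ar.order_trans by blast
  qed
qed

lemma size_eq_psum:
  assumes "fin_seq D k" shows "size D = psum D k"
proof -
  have "(\<exists>s l. fin_seq D l \<and> fin_seq s (l \<oplus> \<one>) \<and> entry s \<zero> = \<zero> \<and>
     (\<forall>i. i \<prec> l \<longrightarrow> entry s (i \<oplus> \<one>) = entry s i \<oplus> row D i) \<and> n = entry s l) \<longleftrightarrow>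
     (\<exists>s. is_sums D s k \<and> n = ent s k)" for n
    unfolding is_sums_def ent_eq_entry[OF assms]
    using ent_eq_entry fin_seq_length_unique[OF assms] assms by metis
  then show ?thesis unfolding size_def psum_def by simp
qed

lemma size_eq_psum_leq:
  assumes D: "diagram D" and "D \<preceq> l" shows "size D = psum D l"
proof -
  have *: "ent D i = \<zero>" if "\<not> i \<prec> col D \<zero>" for i
    unfolding ent_eq_entry[OF col_zero(1)[OF D]] using fin_seq_entry_outside[OF col_zero(1)[OF D] that] .
  have "col D \<zero> \<preceq> l" using col_zero(2)[OF D] assms(2) ar.order_trans by blast
  with psum_eventually[of "col D \<zero>" D l, OF *] show ?thesis
    using size_eq_psum[OF col_zero(1)[OF D]] by simp
qed

lemma size_leq:
  assumes D: "diagram D" shows "size D \<preceq> row D \<zero> \<otimes> col D \<zero>"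
  unfolding size_eq_psum[OF col_zero(1)[OF D]]
proof (rule psum_leq)
  show "ent D i \<preceq> row D \<zero>" for i
    unfolding diagram_ent[OF D] by (intro diagram_row_antimono[OF D]) simp
qed

lemma size_strict_mono:
  assumes D: "diagram D" and E: "diagram E" and "dless D E"
  shows "size D \<prec> size E"
proof -
  have le: "ent D i \<preceq> ent E i" for i
    using assms(3) by (simp add: dless_def dle_def diagram_ent D E)
  have "D \<noteq> E" using assms(3) by (simp add: dless_def)
  then obtain k where "row D k \<noteq> row E k" using diagram_eqI[OF D E] by blast
  then have k: "ent D k \<prec> ent E k" using le[of k] by (simp add: leq_def diagram_ent D E)
  \<comment> \<open>A common summation range: long enough for both sums to be complete, and past the
    row \<open>k\<close> in which the diagrams differ.\<close>
  let ?l = "D \<oplus> E \<oplus> (k \<oplus> \<one>)"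
  have "D \<preceq> D \<oplus> E" "E \<preceq> D \<oplus> E" "D \<oplus> E \<preceq> ?l" by simp_all
  then have "D \<preceq> ?l" "E \<preceq> ?l" using ar.order_trans by blast+
  moreover have "k \<oplus> \<one> \<preceq> ?l" by (simp only: ar.le_add_same_cancel2 zero_leq)
  then have "k \<prec> ?l" by (simp only: add_one_leq_iff)
  ultimately show ?thesis
    using psum_strict_mono[OF le k] size_eq_psum_leq[OF D] size_eq_psum_leq[OF E] by simp
qed

end

section \<open>The claims for a fixed finite set of diagrams\<close>

locale rca0_diagrams = rca0 M for M :: "'m l2_structure" (structure) +
  fixes S :: "'m set"
  assumes finite: "finite_diagram_set S"
begin

lemma S_diagram: "D \<in> S \<Longrightarrow> diagram D"
  using finite by (simp add: finite_diagram_set_def diagram_set_def)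

lemma S_bound: "\<exists>k. \<forall>D\<in>S. D \<prec> k"
  using finite unfolding finite_diagram_set_def by blast

lemma ucl_hat_iff: "F \<in> ucl (hat S) \<longleftrightarrow>
    diagram F \<and> (\<exists>D\<in>S. \<exists>E\<in>S. dle (reduce_r D) F \<and> dle (reduce_c E) F)"
proof -
  have "D \<in> S \<Longrightarrow> E \<in> S \<Longrightarrow> dle (dunion (reduce_r D) (reduce_c E)) F \<longleftrightarrow>
      dle (reduce_r D) F \<and> dle (reduce_c E) F" for D E
    by (intro dle_dunion_iff reduce_r_rows(1) reduce_c_rows(1) S_diagram)
  then show ?thesis unfolding ucl_def hat_def by blast
qed

lemma ucl_subset_ucl_hat: "ucl S \<subseteq> ucl (hat S)"
proof
  fix F assume "F \<in> ucl S"
  then obtain D where D: "diagram F" "D \<in> S" "dle D F" unfolding ucl_def by blast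
  have "dle (reduce_r D) F" "dle (reduce_c D) F"
    unfolding dle_reduce_r_iff[OF S_diagram[OF D(2)] D(1)] dle_reduce_c_iff[OF S_diagram[OF D(2)]]
    using D(3) unfolding dle_def by blast+
  with D show "F \<in> ucl (hat S)" unfolding ucl_hat_iff by blast
qed

text \<open>The description \<open>norm S\<close> denotes once \<open>norm_values S\<close> has a
  greatest element. Row and column lengths are at most the code of their diagram, so
  \<open>k \<otimes> k\<close> bounds all values when \<open>k\<close> bounds
  \<open>S\<close>.\<close>

lemma norm_values_leq_norm:
  assumes "v \<in> norm_values S" shows "v \<preceq> norm S"
proof -
  obtain k where k: "\<And>D. D \<in> S \<Longrightarrow> D \<prec> k" using S_bound by blast
  have S: "S \<in> Sets M" using finite by (simp add: finite_diagram_set_def diagram_set_def)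
  \<comment> \<open>Rows are read with \<open>ent\<close>, and the first column is expressed as the
    length of the sequence; for both there are definability rules.\<close>
  have iff: "v \<in> norm_values S \<longleftrightarrow> (\<exists>D E p q. D \<in> S \<and> E \<in> S \<and> ent D \<zero> = p \<oplus> \<one> \<and>
      fin_seq E (q \<oplus> \<one>) \<and> v = p \<otimes> q)" for v
  proof -
    have "ent D \<zero> = row D \<zero>" "fin_seq D (q \<oplus> \<one>) \<longleftrightarrow> col D \<zero> = q \<oplus> \<one>" if "D \<in> S" for D q
      using that S_diagram diagram_ent col_zero(1) fin_seq_length_unique by metis+
    then show ?thesis unfolding norm_values_def mem_Collect_eq by metis
  qed
  have "sigma1 (\<lambda>e. e 0 \<in> norm_values S)"
    unfolding iff by (intro sigma1_ex sigma1_delta1 delta1_intros delta1_fin_seq recfn_ent S)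
  moreover have "v \<preceq> k \<otimes> k" if v: "v \<in> norm_values S" for v
  proof -
    obtain D E p q where *: "D \<in> S" "E \<in> S" "row D \<zero> = p \<oplus> \<one>" "col E \<zero> = q \<oplus> \<one>" "v = p \<otimes> q"
      using v unfolding norm_values_def by blast
    have "p \<oplus> \<one> \<preceq> D" "q \<oplus> \<one> \<preceq> E"
      using diagram_row_leq[OF S_diagram[OF *(1)], of \<zero>] col_zero(2)[OF S_diagram[OF *(2)]]
      by (simp_all add: *)
    then have "p \<preceq> k" "q \<preceq> k"
      using k[OF *(1)] k[OF *(2)] unfolding add_one_leq_iff using ar.less_trans ar.less_imp_le by blast+
    then show ?thesis unfolding *(5) by (intro ar.mult_mono) simp_all
  qed
  ultimately obtain n where n: "n \<in> norm_values S" "\<forall>v. v \<in> norm_values S \<longrightarrow> v \<preceq> n"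
    using sigma1_greatest[of "\<lambda>v. v \<in> norm_values S", OF _ assms] by blast
  have "norm S = n" unfolding norm_def
    by (rule the_equality) (use n ar.order_antisym in blast)+
  with n assms show ?thesis by blast
qed

lemma ucl_hat_eq: "ucl (hat S) = bar S \<union> ucl S"
proof
  show "bar S \<union> ucl S \<subseteq> ucl (hat S)" using ucl_subset_ucl_hat by (auto simp: bar_def)
  show "ucl (hat S) \<subseteq> bar S \<union> ucl S"
  proof
    fix F assume F: "F \<in> ucl (hat S)"
    then obtain D E where *: "diagram F" "D \<in> S" "E \<in> S" "dle (reduce_r D) F" "dle (reduce_c E) F"
      unfolding ucl_hat_iff by blast
    note diag = *(1) S_diagram[OF *(2)] S_diagram[OF *(3)]
    have "size F \<preceq> norm S" if "F \<notin> ucl S"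
    proof -
      have "\<not> dle D F" "\<not> dle E F" using that * unfolding ucl_def by blast+
      then have "row F \<zero> \<prec> row D \<zero>" "col F \<zero> \<prec> col E \<zero>"
        using dle_if_reduce_r[OF diag(2,1) *(4)] dle_if_reduce_c[OF diag(3) *(5)]
          ar.not_le ar.less_le_trans less_col_iff[OF diag(1), of _ \<zero>] less_col_iff[OF diag(3), of _ \<zero>]
        by metis+
      moreover obtain p q where pq: "row D \<zero> = p \<oplus> \<one>" "col E \<zero> = q \<oplus> \<one>"
        using zero_or_add_one calculation not_less_zero by metis
      ultimately have "row F \<zero> \<preceq> p" "col F \<zero> \<preceq> q" by (simp_all add: less_add_one_iff)
      then have "row F \<zero> \<otimes> col F \<zero> \<preceq> p \<otimes> q" by (intro ar.mult_mono) simp_all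
      moreover have "p \<otimes> q \<in> norm_values S" using pq * unfolding norm_values_def by blast
      ultimately show ?thesis
        using size_leq[OF diag(1)] norm_values_leq_norm ar.order_trans by blast
    qed
    with F show "F \<in> bar S \<union> ucl S" unfolding bar_def by blast
  qed
qed

text \<open>Membership is \<open>\<Delta>\<^sup>0\<^sub>1\<close>: \<open>D\<close> and
  \<open>E\<close> are searched below a bound of \<open>S\<close>, and comparing rows with index
  below the code is enough, the remaining rows being empty.\<close>

lemma diagram_set_ucl_hat: "diagram_set (ucl (hat S))"
proof -
  obtain k where k: "\<And>D. D \<in> S \<Longrightarrow> D \<prec> k" using S_bound by blast
  have S: "S \<in> Sets M" using finite by (simp add: finite_diagram_set_def diagram_set_def)
  have r: "dle (reduce_r D) F \<longleftrightarrow> (\<forall>i. i \<prec> D \<longrightarrow> \<zero> \<prec> i \<longrightarrow> ent D i \<preceq> ent F i)"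
    and c: "dle (reduce_c D) F \<longleftrightarrow> (\<forall>i. i \<prec> D \<longrightarrow> i = \<zero> \<or> \<one> \<prec> ent D i \<longrightarrow> ent D i \<preceq> ent F i)"
    if D: "D \<in> S" and F: "diagram F" for D F
  proof -
    have "row D i = \<zero>" if "\<not> i \<prec> D" for i
      using diagram_row_outside[OF S_diagram[OF D]] that ar.not_less by blast
    then have "row D i \<preceq> row F i" if "\<not> i \<prec> D" for i using that by simp
    then show "dle (reduce_r D) F \<longleftrightarrow> (\<forall>i. i \<prec> D \<longrightarrow> \<zero> \<prec> i \<longrightarrow> ent D i \<preceq> ent F i)"
      "dle (reduce_c D) F \<longleftrightarrow> (\<forall>i. i \<prec> D \<longrightarrow> i = \<zero> \<or> \<one> \<prec> ent D i \<longrightarrow> ent D i \<preceq> ent F i)"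
      unfolding dle_reduce_r_iff[OF S_diagram[OF D] F] dle_reduce_c_iff[OF S_diagram[OF D]]
        diagram_ent[OF F] diagram_ent[OF S_diagram[OF D]] by blast+
  qed
  have "F \<in> ucl (hat S) \<longleftrightarrow> diagram F \<and> (\<exists>D. D \<prec> k \<and> D \<in> S \<and> (\<exists>E. E \<prec> k \<and> E \<in> S \<and>
      (\<forall>i. i \<prec> D \<longrightarrow> \<zero> \<prec> i \<longrightarrow> ent D i \<preceq> ent F i) \<and>
      (\<forall>i. i \<prec> E \<longrightarrow> i = \<zero> \<or> \<one> \<prec> ent E i \<longrightarrow> ent E i \<preceq> ent F i)))" for F
    unfolding ucl_hat_iff using r c k by blast
  then have "delta1 (\<lambda>e. e 0 \<in> ucl (hat S))"
    by (simp only:) (intro delta1_intros delta1_diagram recfn_ent S)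
  then have "ucl (hat S) \<in> Sets M" using delta1_comprehension[of "\<lambda>F. F \<in> ucl (hat S)"] by simp
  then show ?thesis unfolding diagram_set_def ucl_def by blast
qed

lemma closed_ucl_hat: "closed (ucl (hat S))"
  unfolding closed_def
proof (intro allI impI iffI)
  fix D E assume "D \<in> ucl (hat S)" "diagram E \<and> dless D E"
  then show "E \<in> ucl (hat S)" unfolding ucl_def dless_def using dle_trans by blast
next
  fix D assume D: "diagram D" and U: "\<forall>E. diagram E \<and> dless D E \<longrightarrow> E \<in> ucl (hat S)"
  obtain A where A: "A \<in> S" "dle (reduce_r A) D"
  proof -
    let ?f = "\<lambda>i. if i = \<zero> then row D \<zero> \<oplus> \<one> else row D i"
    have le: "row D i \<preceq> ?f i" for i by simp
    have "\<exists>F. diagram F \<and> (\<forall>i. row F i = ?f i)"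
    proof (rule diagram_exists[where l = "D \<oplus> \<one>"])
      show "recfn (\<lambda>e. ?f (e 0))" by (intro recfn_if recfn_row D delta1_intros)
      show "?f j \<preceq> ?f i" if ij: "i \<preceq> j" for i j
      proof (cases "j = \<zero>")
        case True
        then show ?thesis using ij by (simp add: leq_zero_iff)
      next
        case False
        then show ?thesis using ar.order_trans[OF diagram_row_antimono[OF D ij] le[of i]] by simp
      qed
      show "\<zero> \<prec> ?f \<zero>" using diagram_row_zero[OF D] le ar.less_le_trans by blast
      show "?f (D \<oplus> \<one>) = \<zero>" using diagram_row_outside[OF D, of "D \<oplus> \<one>"] add_one_neq_zero by simp
    qed
    then obtain F where F: "diagram F" "\<And>i. row F i = ?f i" by blast
    have "row D \<zero> \<prec> row F \<zero>" by (simp add: F(2))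
    then have "D \<noteq> F" using less_irrefl by auto
    then have "F \<in> ucl (hat S)" using U F le unfolding dless_def dle_def by auto
    then obtain A where A: "A \<in> S" "dle (reduce_r A) F" unfolding ucl_hat_iff by blast
    have "row A i \<preceq> row D i" if "\<zero> \<prec> i" for i
      using A(2) that unfolding dle_reduce_r_iff[OF S_diagram[OF A(1)] F(1)] F(2) zero_less_iff by presburger
    then have "dle (reduce_r A) D" unfolding dle_reduce_r_iff[OF S_diagram[OF A(1)] D] by blast
    with A(1) show thesis by (rule that)
  qed
  obtain B where B: "B \<in> S" "dle (reduce_c B) D"
  proof -
    let ?l = "col D \<zero> \<oplus> \<one>"
    \<comment> \<open>All rows below \<open>?l\<close> are raised to at least one box. Those with
      index below \<open>col D \<zero>\<close> already have one, so the single new box is in the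
      first empty row, whose index is \<open>col D \<zero>\<close>.\<close>
    let ?f = "\<lambda>i. maximum (row D i) (if i \<prec> ?l then \<one> else \<zero>)"
    have l: "col D \<zero> \<prec> ?l" by (simp add: less_add_one_iff)
    have le: "row D i \<preceq> ?f i" for i by (rule leq_maximum1)
    have pos: "\<zero> \<prec> ?f i" if "i \<prec> ?l" for i using that by (simp add: less_maximum_iff)
    have "\<exists>F. diagram F \<and> (\<forall>i. row F i = ?f i)"
    proof (rule diagram_exists[where l = ?l])
      show "recfn (\<lambda>e. ?f (e 0))" by (intro recfn_maximum recfn_if recfn_row D delta1_intros)
      show "?f j \<preceq> ?f i" if ij: "i \<preceq> j" for i j
      proof -
        have "row D j \<preceq> ?f i" using diagram_row_antimono[OF D ij] le ar.order_trans by blast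
        moreover have "\<one> \<preceq> ?f i" if "j \<prec> ?l"
          using pos[of i] ij that ar.le_less_trans by (simp only: one_leq_iff)
        ultimately show ?thesis unfolding maximum_leq_iff[of "row D j"] by simp
      qed
      show "\<zero> \<prec> ?f \<zero>" using diagram_row_zero[OF D] le ar.less_le_trans by blast
      have "\<not> \<zero> \<prec> row D ?l" using l less_col_iff[OF D] ar.less_asym by blast
      then show "?f ?l = \<zero>" by (simp add: zero_less_iff maximum_def)
    qed
    then obtain F where F: "diagram F" "\<And>i. row F i = ?f i" by blast
    have "row D (col D \<zero>) \<noteq> row F (col D \<zero>)"
      using pos[OF l] less_col_iff[OF D, of "col D \<zero>" \<zero>] less_irrefl unfolding F(2) by metis
    then have "D \<noteq> F" by blast
    moreover have "dle D F" using le unfolding dle_def F(2) by blast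
    ultimately have "F \<in> ucl (hat S)" using U F(1) unfolding dless_def by blast
    then obtain B where B: "B \<in> S" "dle (reduce_c B) F" unfolding ucl_hat_iff by blast
    have "row B i \<preceq> row D i" if i: "i = \<zero> \<or> \<one> \<prec> row B i" for i
    proof -
      have "row B i \<preceq> ?f i"
        using B(2) i unfolding dle_reduce_c_iff[OF S_diagram[OF B(1)]] F(2) by blast
      have le1: "(if i \<prec> ?l then \<one> else \<zero>) \<preceq> \<one>" by simp
      \<comment> \<open>Wherever \<open>reduce_c B\<close> imposes a condition, \<open>D\<close>
        already has a box in that row, so \<open>F\<close> and \<open>D\<close> agree there.\<close>
      have "\<one> \<preceq> row D i"
      proof (cases "i = \<zero>")
        case True
        then show ?thesis using diagram_row_zero[OF D] by (simp only: one_leq_iff)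
      next
        case False
        then have "\<one> \<prec> ?f i" using i \<open>row B i \<preceq> ?f i\<close> ar.less_le_trans by blast
        then have "\<one> \<prec> row D i" using ar.leD[OF le1] unfolding less_maximum_iff by blast
        then show ?thesis by (rule ar.less_imp_le)
      qed
      with le1 have "\<not> row D i \<prec> (if i \<prec> ?l then \<one> else \<zero>)"
        using ar.order_trans ar.not_less by blast
      then have "?f i = row D i" unfolding maximum_def by (simp only: if_False)
      with \<open>row B i \<preceq> ?f i\<close> show ?thesis by simp
    qed
    then have "dle (reduce_c B) D" unfolding dle_reduce_c_iff[OF S_diagram[OF B(1)]] by blast
    with B(1) show thesis by (rule that)
  qed
  from A B D show "D \<in> ucl (hat S)" unfolding ucl_hat_iff by blast
qed

lemma ucl_hat_least:
  assumes U: "diagram_set U" "closed U" "S \<subseteq> U"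
  shows "ucl (hat S) \<subseteq> U"
proof (rule ccontr)
  assume "\<not> ucl (hat S) \<subseteq> U"
  then obtain F0 where F0: "F0 \<in> ucl (hat S)" "F0 \<notin> U" by blast
  have up: "E \<in> U" if "D \<in> U" "diagram E" "dle D E" for D E
    using that U(1,2) unfolding diagram_set_def closed_def dless_def by metis
  then have ucl: "ucl S \<subseteq> U" using U(3) unfolding ucl_def by blast
  have diag: "diagram F" if "F \<in> ucl (hat S)" for F using that unfolding ucl_def by blast
  \<comment> \<open>Since \<open>F\<close> has no rows with index \<open>F\<close> or more,
    \<open>psum F F\<close> is its size, in a form known to be recursive.\<close>
  let ?P = "\<lambda>n. \<exists>F. F \<in> ucl (hat S) \<and> F \<notin> U \<and> n = psum F F"
  have P: "?P n \<longleftrightarrow> (\<exists>F. F \<in> ucl (hat S) \<and> F \<notin> U \<and> n = size F)" for n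
    using size_eq_psum_leq[OF diag, OF _ ar.order_refl] by metis
  have "sigma1 (\<lambda>e. ?P (e 0))"
    using U(1) diagram_set_ucl_hat unfolding diagram_set_def
    by (intro sigma1_ex sigma1_delta1 delta1_intros recfn_psum) blast+
  moreover have "?P (size F0)" unfolding P using F0 by blast
  moreover have "n \<preceq> norm S" if n: "?P n" for n
  proof -
    obtain F where F: "F \<in> ucl (hat S)" "F \<notin> U" "n = size F" using n unfolding P by blast
    then have "F \<in> bar S" using ucl_hat_eq ucl by blast
    then show ?thesis by (simp add: bar_def F(3))
  qed
  ultimately obtain n where "?P n" and max: "\<And>m. ?P m \<Longrightarrow> m \<preceq> n"
    using sigma1_greatest[of ?P] by blast
  then obtain F where F: "F \<in> ucl (hat S)" "F \<notin> U" "n = size F" unfolding P by blast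
  have "E \<in> U" if E: "diagram E" "dless F E" for E
  proof (rule ccontr)
    assume "E \<notin> U"
    moreover have "E \<in> ucl (hat S)"
      using F(1) E unfolding ucl_def dless_def using dle_trans by blast
    ultimately have "size E \<preceq> size F" using max F(3) unfolding P by blast
    then show False using size_strict_mono[OF diag[OF F(1)] E] ar.not_le by blast
  qed
  then have "F \<in> U" using U(2) diag[OF F(1)] unfolding closed_def by blast
  with F(2) show False ..
qed

end

theorem theorem3p8:
  fixes M :: "'m l2_structure" and S :: "'m set"
  assumes "rca0 M"
    and "l2.finite_diagram_set M S"
  shows "l2.ucl M (l2.hat M S) = l2.bar M S \<union> l2.ucl M S
    \<and> l2.diagram_set M (l2.ucl M (l2.hat M S))
    \<and> l2.closed M (l2.ucl M (l2.hat M S))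
    \<and> S \<subseteq> l2.ucl M (l2.hat M S)
    \<and> (\<forall>U. l2.diagram_set M U \<and> l2.closed M U \<and> S \<subseteq> U \<longrightarrow> l2.ucl M (l2.hat M S) \<subseteq> U)"
proof -
  interpret rca0_diagrams M S
    using assms by (simp add: rca0_diagrams_def rca0_diagrams_axioms_def)
  have "S \<subseteq> ucl S" using S_diagram dle_refl unfolding ucl_def by blast
  then show ?thesis
    using ucl_hat_eq diagram_set_ucl_hat closed_ucl_hat ucl_hat_least ucl_subset_ucl_hat by blast
qed

end
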